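(* For every $n\geqslant 2$ there is a constant $A_n>0$ depending only on $n$ such that for every convex body $K$ in $\mathbb{R}^n$, $$S(K)\leqslant A_n\,S(K)^{\frac{1}{n-1}}\max_{\xi\in S^{n-1}}S(K\cap\xi^{\perp}).$$
   Context: A convex body in $\mathbb{R}^n$ is a compact convex set with non-empty interior. $S^{n-1}$ is the Euclidean unit sphere and $\xi^\perp=\{x\in\mathbb{R}^n:\langle x,\xi\rangle=0\}$. $S(A)$ denotes surface area in the appropriate dimension: if $A$ is a non-empty compact convex set in an $m$-dimensional Euclidean space $E$ with unit ball $B_E$, then $S(A)=\lim_{t\to0^+}\frac{|A+tB_E|-|A|}{t}$ ($m$-dimensional volume), and $S(\emptyset)=0$; $S(K\cap\xi^\perp)$ is computed in the $(n-1)$-dimensional space $\xi^\perp$ (it equals $2$ for a segment when $n=2$). *)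

theory Defs
  imports "HOL-Analysis.Analysis"
begin

definition convex_body :: "'a::euclidean_space set \<Rightarrow> bool" where
  "convex_body K \<longleftrightarrow> compact K \<and> convex K \<and> interior K \<noteq> {}"

definition orthonormal_basis_of :: "'a::euclidean_space set \<Rightarrow> 'a set \<Rightarrow> bool" where
  "orthonormal_basis_of E B \<longleftrightarrow>
     B \<subseteq> E \<and> pairwise orthogonal B \<and> (\<forall>b\<in>B. norm b = 1) \<and> span B = E"

text \<open>
  Lebesgue measure of the appropriate dimension on a linear subspace \<open>E\<close>, regarded as a Borel
  measure on the whole space concentrated on \<open>E\<close>: the product measure in orthonormal
  coordinates, exactly as \<open>lborel\<close> is constructed from \<open>Basis\<close>. The measure does not depend on
  the orthonormal basis chosen.
\<close>
definition subspace_lborel :: "'a::euclidean_space set \<Rightarrow> 'a measure" where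
  "subspace_lborel E =
     (let B = (SOME B. orthonormal_basis_of E B)
      in distr (\<Pi>\<^sub>M b\<in>B. (lborel :: real measure)) borel (\<lambda>f. \<Sum>b\<in>B. f b *\<^sub>R b))"

text \<open>
  Surface area of a compact convex set \<open>A\<close> contained in the subspace \<open>E\<close>, relative to \<open>E\<close>; the
  unit ball of \<open>E\<close> is \<open>cball 0 1 \<inter> E\<close>.
\<close>
definition surface_area :: "'a::euclidean_space set \<Rightarrow> 'a set \<Rightarrow> real" where
  "surface_area E A =
     (if A = {} then 0
      else Lim (at_right 0) (\<lambda>t.
        (measure (subspace_lborel E) {a + t *\<^sub>R b |a b. a \<in> A \<and> b \<in> cball 0 1 \<inter> E}
          - measure (subspace_lborel E) A) / t))"

definition perp :: "'a::euclidean_space \<Rightarrow> 'a set" where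
  "perp \<xi> = {x. x \<bullet> \<xi> = 0}"

end

theory Submission
  imports Defs
begin

text \<open>
  The proof compares \<open>K\<close> with a box. Fix \<open>x0 \<in> K\<close> and choose points of \<open>K\<close> greedily: \<open>p 0\<close> is
  farthest from \<open>x0\<close>, \<open>p 1\<close> farthest from the line through \<open>x0\<close> and \<open>p 0\<close>, \<open>p 2\<close> farthest from the
  plane through \<open>x0\<close>, \<open>p 0\<close>, \<open>p 1\<close>, and so on. The distances \<open>d 0 \<ge> d 1 \<ge> \<dots>\<close> decrease, and in the
  Gram-Schmidt frame \<open>e\<close> of these points \<open>K\<close> lies in the box \<open>\<bar>(y - x0) \<bullet> e i\<bar> \<le> d i\<close>
  (\<open>adapted_frame_exists\<close>). Write \<open>n = m + 2\<close> and \<open>P = d 0 \<cdots> d (m - 1)\<close>.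

  \<^item> Surface area is at most \<open>(|K + t B| - |K|) / t\<close> for every \<open>t > 0\<close>. With \<open>t = d (n - 1)\<close> the set
    \<open>K + t B\<close> lies in a box with sides \<open>4 d i\<close>, so \<open>S(K) \<le> 4^n P (d m)\<close>
    (\<open>surface_area_upper_bound\<close>).

  \<^item> The \<open>n - 1\<close> points \<open>x0, p 0, \<dots>, p (m - 1)\<close> lie in some hyperplane through the origin, wherever
    the origin is. The section by it contains an \<open>m\<close>-dimensional parallelepiped of volume
    \<open>P / m^m\<close>. A set that is flat in the hyperplane has twice its volume as surface area, so the
    surface area of the section is at least \<open>P / m^m\<close> (\<open>section_area_lower_bound\<close>).

  Since \<open>(d m)^m \<le> P\<close>, these two bounds give \<open>S(K)^(m + 1) \<le> S(K) (4^n P)^(m + 1)\<close>, which is the claim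
  with the constant \<open>4^n m^m\<close>.

  Three properties of surface area enter: the limit defining it exists and is bounded by the
  difference quotients, it is monotone under inclusion, and the maximum over all sections is
  attained. All of them follow from one inequality,
  \<open>|C + tB| - |C| \<le> |C' + tB| - |C'|\<close> for compact convex \<open>C \<subseteq> C'\<close>
  (\<open>vol_add_ball_mono\<close>). For a segment in place of the ball, each side is the volume of a fundamental
  domain of the translations by integer multiples of the segment, which act on a larger set on the
  right-hand side (\<open>emeasure_swept_mono\<close>). Adding segments one after the other gives the inequality for zonotopes, and
  the ball is a limit of zonotopes, because \<open>\<integral> \<bar>x \<bullet> u\<bar> du\<close> over the unit ball is a multiple of the norm
  of \<open>x\<close> and Riemann sums of this integral are support functions of zonotopes
  (\<open>ball_approx_by_zonotope\<close>). With \<open>C' = C + sB\<close> the inequality says that \<open>|C + tB| - |C|\<close> is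
  superadditive in \<open>t\<close>; hence its quotient by \<open>t\<close> converges to its infimum
  (\<open>superadditive_quotient_tendsto\<close>). An infimum of monotone quantities that depend continuously on
  the body is upper semicontinuous, which yields the maximum (\<open>section_area_usc\<close>).

  The volume of a set \<open>A\<close> in the hyperplane orthogonal to a unit vector \<open>\<xi>\<close> is the \<open>n\<close>-dimensional
  volume of the cylinder \<open>A + [0, \<xi>]\<close>. The whole argument therefore takes place in the full space,
  with the ball replaced by its image under the orthogonal projection.
\<close>

section \<open>Volume under linear maps\<close>

text \<open>
  The formula for the volume of a linear image in terms of the determinant refers to an ordering of
  the coordinates. Through a copy of a finite index type, ordered by an arbitrary enumeration, its
  consequences carry over to index types without an ordering.
\<close>
datatype 'a ord_copy = Ord_Copy (original: 'a)

lemma original_bij: "bij (original :: 'a ord_copy \<Rightarrow> 'a)"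
  by (rule bijI') (auto simp: ord_copy.expand, metis ord_copy.sel)

instance ord_copy :: (finite) finite
proof
  show "finite (UNIV :: 'a ord_copy set)"
    using bij_betw_finite[OF original_bij] finite_class.finite_UNIV by blast
qed

definition position :: "'a::finite \<Rightarrow> nat" where
  "position = (SOME f. inj f)"

lemma inj_position: "inj (position :: 'a::finite \<Rightarrow> nat)"
  unfolding position_def
  using finite_imp_inj_to_nat_seg[OF finite_class.finite_UNIV] by (metis someI_ex)

instantiation ord_copy :: (finite) wellorder
begin

definition "x \<le> y \<longleftrightarrow> position (original x) \<le> position (original y)"
definition "x < y \<longleftrightarrow> position (original x) < position (original y)"

instance
proof
  fix x y z :: "'a ord_copy"
  show "x < y \<longleftrightarrow> x \<le> y \<and> \<not> y \<le> x" "x \<le> x" "x \<le> y \<or> y \<le> x"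
    by (auto simp: less_eq_ord_copy_def less_ord_copy_def)
  show "x \<le> y \<Longrightarrow> y \<le> z \<Longrightarrow> x \<le> z"
    by (auto simp: less_eq_ord_copy_def)
  show "x \<le> y \<Longrightarrow> y \<le> x \<Longrightarrow> x = y"
    by (metis less_eq_ord_copy_def le_antisym injD[OF inj_position] ord_copy.expand)
next
  fix P :: "'a ord_copy \<Rightarrow> bool" and a
  assume *: "\<And>x. (\<And>y. y < x \<Longrightarrow> P y) \<Longrightarrow> P x"
  show "P a"
    by (induction a rule: measure_induct_rule[where f = "position \<circ> original"])
       (rule *, simp add: less_ord_copy_def)
qed

end

definition copy_coords :: "real ^ 'n::finite \<Rightarrow> real ^ 'n ord_copy" where
  "copy_coords x = (\<chi> i. x $ original i)"

lemma linear_copy_coords: "linear copy_coords"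
  by (rule linearI) (auto simp: copy_coords_def vec_eq_iff)

lemma copy_coords_inner: "copy_coords x \<bullet> copy_coords y = x \<bullet> y"
  unfolding inner_vec_def copy_coords_def
  using sum.reindex_bij_betw[OF original_bij, of "\<lambda>i. x $ i \<bullet> y $ i"] by simp

lemma bij_copy_coords: "bij copy_coords"
proof (rule bijI')
  show "(copy_coords x = copy_coords y) = (x = y)" for x y :: "real ^ 'n::finite"
    by (auto simp: copy_coords_def vec_eq_iff) (metis ord_copy.sel)
  show "\<exists>x. y = copy_coords x" for y :: "real ^ 'n::finite ord_copy"
    by (rule exI[of _ "\<chi> i. y $ Ord_Copy i"]) (simp add: copy_coords_def vec_eq_iff)
qed

lemma prod_Basis_cart: "(\<Prod>b\<in>Basis. (v :: real ^ 'm::finite) \<bullet> b) = (\<Prod>i\<in>UNIV. v $ i)"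
proof -
  have "(\<Prod>b\<in>Basis. v \<bullet> b) = (\<Prod>b\<in>range (\<lambda>i. axis i (1::real)). v \<bullet> b)"
    by (rule prod.cong) (auto simp: Basis_vec_def)
  also have "\<dots> = (\<Prod>i\<in>UNIV. v $ i)"
    by (subst prod.reindex) (auto simp: inj_on_def axis_eq_axis inner_axis)
  finally show ?thesis .
qed

lemma distr_copy_coords: "distr lborel borel (copy_coords :: real ^ 'n::finite \<Rightarrow> _) = lborel"
proof (rule sym, rule lborel_eqI)
  have [measurable]: "copy_coords \<in> borel_measurable (borel :: (real^'n) measure)"
    by (intro borel_measurable_continuous_onI linear_continuous_on linear_conv_bounded_linear[THEN iffD1] linear_copy_coords)
  fix l u :: "real ^ 'n ord_copy"
  assume lu: "\<And>b. b \<in> Basis \<Longrightarrow> l \<bullet> b \<le> u \<bullet> b"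
  have lu': "l $ i \<le> u $ i" for i
    using lu[of "axis i 1"] by (auto simp: Basis_vec_def inner_axis)
  define l' u' where "l' = inv copy_coords l" and "u' = inv copy_coords u"
  have l: "l = copy_coords l'" and u: "u = copy_coords u'"
    unfolding l'_def u'_def by (simp_all add: surj_f_inv_f[OF bij_is_surj[OF bij_copy_coords]])
  have "copy_coords -` box l u = box l' u'"
    unfolding l u by (auto simp: mem_box_cart copy_coords_def) (metis ord_copy.sel)+
  moreover have "(\<Prod>i\<in>UNIV. u $ i - l $ i) = (\<Prod>i\<in>UNIV. u' $ i - l' $ i)"
    unfolding l u copy_coords_def
    using prod.reindex_bij_betw[OF original_bij, of "\<lambda>i. u' $ i - l' $ i"] by simp
  moreover have "l' \<bullet> b \<le> u' \<bullet> b" if "b \<in> Basis" for b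
  proof -
    obtain i where i: "b = axis i 1" using \<open>b \<in> Basis\<close> by (auto simp: Basis_vec_def)
    show ?thesis using lu'[of "Ord_Copy i"] unfolding l u i by (simp add: copy_coords_def inner_axis)
  qed
  ultimately show "emeasure (distr lborel borel copy_coords) (box l u) = (\<Prod>b\<in>Basis. (u - l) \<bullet> b)"
    by (subst emeasure_distr) (auto simp: emeasure_lborel_box_eq prod_Basis_cart)
qed simp

lemma measure_copy_coords:
  fixes S :: "(real ^ 'n::finite) set"
  assumes "compact S"
  shows "measure lebesgue (copy_coords ` S) = measure lebesgue S"
proof -
  have c: "compact (copy_coords ` S)"
    using assms linear_copy_coords by (intro compact_continuous_image linear_continuous_on linear_conv_bounded_linear[THEN iffD1])
  have [measurable]: "copy_coords \<in> borel_measurable (borel :: (real^'n) measure)"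
    by (intro borel_measurable_continuous_onI linear_continuous_on linear_conv_bounded_linear[THEN iffD1] linear_copy_coords)
  have "measure lebesgue (copy_coords ` S) = measure lborel (copy_coords ` S)"
    using c by (simp add: borel_compact)
  also have "\<dots> = measure (distr lborel borel (copy_coords :: real ^ 'n::finite \<Rightarrow> _)) (copy_coords ` S)"
    by (simp add: distr_copy_coords)
  also have "\<dots> = measure lborel (copy_coords -` (copy_coords ` S))"
    using c by (subst measure_distr) (auto simp: borel_compact)
  also have "copy_coords -` (copy_coords ` S) = S"
    by (rule inj_vimage_image_eq[OF bij_is_inj[OF bij_copy_coords]])
  also have "measure lborel S = measure lebesgue S"
    using assms by (simp add: borel_compact)
  finally show ?thesis .
qed

lemma compact_linear_image:
  fixes f :: "'a::euclidean_space \<Rightarrow> 'b::euclidean_space"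
  shows "linear f \<Longrightarrow> compact S \<Longrightarrow> compact (f ` S)"
  by (intro compact_continuous_image linear_continuous_on linear_conv_bounded_linear[THEN iffD1])

lemma measure_orthogonal_image_finite:
  fixes f :: "real ^ 'n::finite \<Rightarrow> real ^ 'n"
  assumes f: "orthogonal_transformation f" and S: "compact S"
  shows "measure lebesgue (f ` S) = measure lebesgue S"
proof -
  let ?\<phi> = "copy_coords :: real ^ 'n \<Rightarrow> _"
  define g where "g = ?\<phi> \<circ> f \<circ> inv ?\<phi>"
  have inv: "?\<phi> (inv ?\<phi> x) = x" "inv ?\<phi> (?\<phi> y) = y" for x y
    by (simp_all add: surj_f_inv_f[OF bij_is_surj[OF bij_copy_coords]] inv_f_f[OF bij_is_inj[OF bij_copy_coords]])
  have "linear (inv ?\<phi>)"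
    by (rule linearI; rule bij_is_inj[OF bij_copy_coords, THEN injD])
       (simp_all add: inv linear_add[OF linear_copy_coords] linear_cmul[OF linear_copy_coords])
  then have "linear g"
    unfolding g_def using f linear_copy_coords
    by (intro linear_compose) (auto simp: orthogonal_transformation_linear)
  moreover have "g x \<bullet> g y = x \<bullet> y" for x y
    using f inv by (simp add: g_def copy_coords_inner orthogonal_transformation_def)
      (metis copy_coords_inner inv(1))
  ultimately have g: "orthogonal_transformation g"
    by (simp add: orthogonal_transformation_def)
  have "?\<phi> ` (f ` S) = g ` (?\<phi> ` S)"
    by (auto simp: g_def inv image_image)
  then show ?thesis
    using measure_orthogonal_image[OF g, of "?\<phi> ` S"] S f
    by (metis compact_linear_image lmeasurable_compact measure_copy_coords linear_copy_coords orthogonal_transformation_linear)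
qed

text \<open>
  A permutation that never increases the rank preserves the sum of all ranks, hence every rank, and
  is therefore the identity; only the diagonal term of the Leibniz sum survives.
\<close>
lemma det_triangular_rank:
  fixes A :: "real ^ 'n::finite ^ 'n" and r :: "'n \<Rightarrow> nat"
  assumes "inj r" and tri: "\<And>i j. r i < r j \<Longrightarrow> A $ i $ j = 0"
  shows "det A = (\<Prod>i\<in>UNIV. A $ i $ i)"
proof -
  let ?U = "UNIV :: 'n set"
  let ?PU = "{p. p permutes ?U}"
  let ?pp = "\<lambda>p. of_int (sign p) * (\<Prod>i\<in>?U. A $ i $ p i)"
  have "?pp p = 0" if p: "p permutes ?U" and "p \<noteq> id" for p
  proof -
    obtain i where "r i < r (p i)"
    proof (rule ccontr)
      assume "\<not> thesis"
      with that have le: "r (p i) \<le> r i" for i by (meson not_le)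
      have "(\<Sum>i\<in>?U. r (p i)) = (\<Sum>i\<in>?U. r i)"
        using sum.permute[OF p, of r] by (simp add: o_def)
      then have "r (p i) = r i" for i
        using sum_mono_inv[of "\<lambda>i. r (p i)" ?U r i] le by auto
      with \<open>inj r\<close> have "p = id" by (auto simp: inj_def)
      with \<open>p \<noteq> id\<close> show False ..
    qed
    then have "(\<Prod>i\<in>?U. A $ i $ p i) = 0"
      using tri by (intro prod_zero) auto
    then show ?thesis by simp
  qed
  then have "det A = (\<Sum>p\<in>{id}. ?pp p)"
    unfolding det_def by (intro sum.mono_neutral_right) (auto simp: permutes_id finite_permutations)
  then show ?thesis by simp
qed

text \<open>
  The matrix of the edges is a triangular matrix times an orthogonal one, so its determinant is the
  product of the diagonal entries \<open>w i \<bullet> e i\<close> up to sign.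
\<close>
lemma measure_parallelepiped_wo:
  fixes e w :: "'n::{finite,wellorder} \<Rightarrow> real ^ 'n::_" and r :: "'n \<Rightarrow> nat"
  assumes "inj r" and orth: "\<And>i j. e i \<bullet> e j = (if i = j then 1 else 0)"
    and tri: "\<And>i j. r i < r j \<Longrightarrow> w i \<bullet> e j = 0"
  shows "measure lebesgue ((\<lambda>x. \<Sum>i\<in>UNIV. x $ i *\<^sub>R w i) ` cbox 0 1) = (\<Prod>i\<in>UNIV. \<bar>w i \<bullet> e i\<bar>)"
proof -
  define f where "f = (\<lambda>x. \<Sum>i\<in>UNIV. x $ i *\<^sub>R w i)"
  have lin: "linear f"
    unfolding f_def by (rule linearI) (auto simp: algebra_simps sum.distrib scaleR_right.sum)
  define W E L where "W = (\<chi> i. w i)" and "E = (\<chi> i. e i)" and "L = (\<chi> i j. w i \<bullet> e j)"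
  have f_ax: "f (axis j 1) = w j" for j
  proof -
    have "f (axis j 1) = (\<Sum>i\<in>UNIV. if i = j then w i else 0)"
      unfolding f_def by (rule sum.cong) (auto simp: axis_def)
    then show ?thesis by simp
  qed
  have mf: "matrix f = transpose W"
    by (simp add: matrix_def transpose_def W_def f_ax vec_eq_iff)
  have "E ** transpose E = mat 1"
    using orth by (auto simp: matrix_matrix_mult_def transpose_def E_def mat_def vec_eq_iff inner_vec_def)
  then have dE: "\<bar>det E\<bar> = 1"
    using det_orthogonal_matrix[of E] by (auto simp: orthogonal_matrix_def matrix_left_right_inverse)
  have "W ** transpose E = L"
    by (auto simp: matrix_matrix_mult_def transpose_def E_def W_def L_def mat_def vec_eq_iff inner_vec_def)
  then have "\<bar>det W\<bar> = \<bar>det L\<bar>"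
    using dE by (metis abs_mult det_mul det_transpose mult.right_neutral)
  also have "det L = (\<Prod>i\<in>UNIV. L $ i $ i)"
    by (rule det_triangular_rank[OF \<open>inj r\<close>]) (simp add: L_def tri)
  finally have "\<bar>det (matrix f)\<bar> = (\<Prod>i\<in>UNIV. \<bar>w i \<bullet> e i\<bar>)"
    by (simp add: mf L_def abs_prod)
  moreover have "measure lebesgue (cbox 0 1 :: (real ^ 'n::_) set) = 1"
    using content_cbox_cart[of "0 :: real ^ 'n::_" 1] by (simp add: interval_eq_empty_cart)
  ultimately show ?thesis
    using measure_linear_image[OF lin, of "cbox 0 1"] by (simp add: f_def)
qed

lemma measure_parallelepiped:
  fixes e w :: "'n::finite \<Rightarrow> real ^ 'n" and r :: "'n \<Rightarrow> nat"
  assumes "inj r" and orth: "\<And>i j. e i \<bullet> e j = (if i = j then 1 else 0)"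
    and tri: "\<And>i j. r i < r j \<Longrightarrow> w i \<bullet> e j = 0"
  shows "measure lebesgue ((\<lambda>x. \<Sum>i\<in>UNIV. x $ i *\<^sub>R w i) ` cbox 0 1) = (\<Prod>i\<in>UNIV. \<bar>w i \<bullet> e i\<bar>)"
proof -
  define e' w' where "e' = (\<lambda>i. copy_coords (e (original i)))" and "w' = (\<lambda>i. copy_coords (w (original i)))"
  have "measure lebesgue ((\<lambda>x. \<Sum>i\<in>UNIV. x $ i *\<^sub>R w' i) ` cbox 0 1) = (\<Prod>i\<in>UNIV. \<bar>w' i \<bullet> e' i\<bar>)"
  proof (rule measure_parallelepiped_wo)
    show "inj (r \<circ> original)"
      using \<open>inj r\<close> bij_is_inj[OF original_bij] by (rule inj_compose)
    show "e' i \<bullet> e' j = (if i = j then 1 else 0)" for i j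
      by (auto simp: e'_def copy_coords_inner orth ord_copy.expand)
    show "(r \<circ> original) i < (r \<circ> original) j \<Longrightarrow> w' i \<bullet> e' j = 0" for i j
      by (simp add: w'_def e'_def copy_coords_inner tri)
  qed
  also have "(\<Prod>i\<in>UNIV. \<bar>w' i \<bullet> e' i\<bar>) = (\<Prod>i\<in>UNIV. \<bar>w i \<bullet> e i\<bar>)"
    using prod.reindex_bij_betw[OF original_bij, of "\<lambda>i. \<bar>w i \<bullet> e i\<bar>"] by (simp add: w'_def e'_def copy_coords_inner)
  also have "(\<lambda>x. \<Sum>i\<in>UNIV. x $ i *\<^sub>R w' i) ` cbox 0 1
    = copy_coords ` (\<lambda>x. \<Sum>i\<in>UNIV. x $ i *\<^sub>R w i) ` cbox 0 1"
  proof -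
    have "copy_coords ` (cbox 0 1 :: (real ^ 'n) set) = cbox 0 1"
    proof (intro equalityI subsetI)
      fix y :: "real ^ 'n ord_copy" assume y: "y \<in> cbox 0 1"
      obtain x where x: "y = copy_coords x" using bij_copy_coords by (metis bij_pointE)
      have "x \<in> cbox 0 1"
        unfolding mem_box_cart
      proof
        fix i show "0 $ i \<le> x $ i \<and> x $ i \<le> 1 $ i"
          using y[unfolded mem_box_cart, rule_format, of "Ord_Copy i"] by (simp add: x copy_coords_def)
      qed
      then show "y \<in> copy_coords ` cbox 0 1" using x by blast
    qed (auto simp: mem_box_cart copy_coords_def)
    moreover have "(\<Sum>i\<in>UNIV. copy_coords x $ i *\<^sub>R w' i) = copy_coords (\<Sum>i\<in>UNIV. x $ i *\<^sub>R w i)" for x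
      using sum.reindex_bij_betw[OF original_bij, of "\<lambda>i. x $ i *\<^sub>R copy_coords (w i)"]
      by (simp add: w'_def linear_sum[OF linear_copy_coords] linear_cmul[OF linear_copy_coords])
         (simp add: copy_coords_def)
    then have "copy_coords ` (\<lambda>x. \<Sum>i\<in>UNIV. x $ i *\<^sub>R w i) ` cbox 0 1
        = (\<lambda>x. \<Sum>i\<in>UNIV. x $ i *\<^sub>R w' i) ` copy_coords ` cbox 0 1"
      by (simp add: image_image)
    ultimately show ?thesis by simp
  qed
  also have "measure lebesgue \<dots> = measure lebesgue ((\<lambda>x. \<Sum>i\<in>UNIV. x $ i *\<^sub>R w i) ` cbox 0 1)"
    by (rule measure_copy_coords, rule compact_linear_image)
       (auto intro!: linearI simp: algebra_simps sum.distrib scaleR_right.sum)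
  finally show ?thesis .
qed

section \<open>Volume swept out by a segment, and by a zonotope\<close>

lemma compact_set_plus:
  fixes A B :: "'a::real_normed_vector set"
  shows "compact A \<Longrightarrow> compact B \<Longrightarrow> compact (A + B)"
proof -
  assume "compact A" "compact B"
  moreover have "A + B = {x + y | x y. x \<in> A \<and> y \<in> B}"
    by (auto simp: set_plus_def)
  ultimately show ?thesis by (simp add: compact_sums)
qed

lemma emeasure_lborel_shift:
  fixes S :: "'a::euclidean_space set"
  assumes [measurable]: "S \<in> sets borel"
  shows "emeasure lborel {x. c + x \<in> S} = emeasure lborel S"
proof -
  have "emeasure lborel S = emeasure (distr lborel borel ((+) c)) S"
    by (simp add: lborel_distr_plus)
  also have "\<dots> = emeasure lborel ((+) c -` S)"
    by (subst emeasure_distr) auto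
  finally show ?thesis by (simp add: vimage_def)
qed

text \<open>
  A line in direction \<open>u\<close> that meets \<open>C\<close> does so in an interval \<open>[a, b]\<close> (in units of \<open>u\<close>), and meets
  the swept body in \<open>[a, b + 1]\<close>. What is new is the half-open interval \<open>(b, b + 1]\<close>, which contains
  exactly one point of each orbit of the translations by integer multiples of \<open>u\<close>.
\<close>
lemma swept_line_section:
  fixes C :: "'a::euclidean_space set"
  assumes C: "compact C" "convex C" and u: "u \<noteq> 0" and ne: "x + s0 *\<^sub>R u \<in> C"
  obtains b where "s0 \<le> b"
    "\<And>s. x + s *\<^sub>R u \<in> (C + closed_segment 0 u) - C \<longleftrightarrow> b < s \<and> s \<le> b + 1"
proof -
  define J where "J = {s. x + s *\<^sub>R u \<in> C}"
  have J: "J = (\<lambda>s. x + s *\<^sub>R u) -` C" by (auto simp: J_def)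
  have "convex J"
    unfolding convex_def J_def
  proof safe
    fix s t a b :: real
    assume *: "x + s *\<^sub>R u \<in> C" "x + t *\<^sub>R u \<in> C" "0 \<le> a" "0 \<le> b" "a + b = 1"
    have "x + (a *\<^sub>R s + b *\<^sub>R t) *\<^sub>R u = (a + b) *\<^sub>R x + (a *\<^sub>R s + b *\<^sub>R t) *\<^sub>R u"
      using * by simp
    also have "\<dots> = a *\<^sub>R (x + s *\<^sub>R u) + b *\<^sub>R (x + t *\<^sub>R u)"
      by (simp add: algebra_simps)
    finally show "x + (a *\<^sub>R s + b *\<^sub>R t) *\<^sub>R u \<in> C"
      using * C(2) by (simp add: convex_def)
  qed
  moreover have "compact J"
  proof -
    have "closed J"
      unfolding J using compact_imp_closed[OF C(1)]
      by (intro continuous_closed_vimage) (auto intro!: continuous_intros)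
    moreover obtain B where B: "\<And>y. y \<in> C \<Longrightarrow> norm y \<le> B"
      using compact_imp_bounded[OF C(1)] by (auto simp: bounded_iff)
    have "norm s \<le> (B + norm x) / norm u" if "s \<in> J" for s
    proof -
      have "norm (s *\<^sub>R u) \<le> norm (x + s *\<^sub>R u) + norm x"
        by (metis add.commute add_diff_cancel_left' norm_triangle_ineq4)
      also have "\<dots> \<le> B + norm x" using that B by (simp add: J_def)
      finally show ?thesis using u by (simp add: field_simps)
    qed
    then have "bounded J" by (auto simp: bounded_iff)
    ultimately show ?thesis by (simp add: compact_eq_bounded_closed)
  qed
  ultimately obtain a b where ab: "J = cbox a b"
    using is_interval_compact is_interval_convex_1 by blast
  have "s \<in> J \<longleftrightarrow> a \<le> s \<and> s \<le> b" for s
    unfolding ab by simp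
  then have in_C: "x + s *\<^sub>R u \<in> C \<longleftrightarrow> a \<le> s \<and> s \<le> b" for s
    unfolding J_def by simp
  have s0: "a \<le> s0" "s0 \<le> b" using ne unfolding in_C by auto
  have in_sw: "x + s *\<^sub>R u \<in> C + closed_segment 0 u \<longleftrightarrow> a \<le> s \<and> s \<le> b + 1" for s
  proof
    assume "x + s *\<^sub>R u \<in> C + closed_segment 0 u"
    then obtain c l where l: "x + s *\<^sub>R u = c + l *\<^sub>R u" "c \<in> C" "0 \<le> l" "l \<le> 1"
      by (auto simp: set_plus_def in_segment)
    then have "x + (s - l) *\<^sub>R u \<in> C" by (simp add: algebra_simps)
    then show "a \<le> s \<and> s \<le> b + 1" using l in_C by auto
  next
    assume s: "a \<le> s \<and> s \<le> b + 1"
    define l where "l = (if s \<le> a + 1 then s - a else 1)"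
    have l: "0 \<le> l" "l \<le> 1" and "x + (s - l) *\<^sub>R u \<in> C"
      using s s0 by (auto simp: l_def in_C)
    moreover have "x + s *\<^sub>R u = (x + (s - l) *\<^sub>R u) + l *\<^sub>R u" by (simp add: algebra_simps)
    moreover have "l *\<^sub>R u \<in> closed_segment 0 u" using l by (auto simp: in_segment)
    ultimately show "x + s *\<^sub>R u \<in> C + closed_segment 0 u"
      by (metis set_plus_intro)
  qed
  show thesis
    by (rule that[of b]) (use s0 in_C in_sw in auto)
qed

text \<open>
  By the preceding lemma, both differences are fundamental domains of the translations by integer
  multiples of \<open>u\<close>, acting on the union of the lines in direction \<open>u\<close> that meet \<open>C\<close> and \<open>C'\<close>,
  respectively. The first is cut into countably many pieces \<open>Y k\<close> so that translating \<open>Y k\<close> by \<open>k u\<close> moves it into the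
  second; the translated pieces \<open>Y' k\<close> stay disjoint because a fundamental domain meets every orbit
  only once. Only \<open>k \<ge> 0\<close> occurs because the larger body leaves each line later.
\<close>
lemma emeasure_swept_mono:
  fixes C C' :: "'a::euclidean_space set"
  assumes C: "compact C" "convex C" and C': "compact C'" "convex C'" and sub: "C \<subseteq> C'" and u: "u \<noteq> 0"
  shows "emeasure lborel ((C + closed_segment 0 u) - C) \<le> emeasure lborel ((C' + closed_segment 0 u) - C')"
proof -
  define R where "R = (\<lambda>X. (X + closed_segment 0 u) - X)"
  have [measurable]: "R C \<in> sets borel" "R C' \<in> sets borel"
    using C C' by (simp_all add: R_def sets.Diff borel_compact compact_set_plus)
  define Y Y' where "Y = (\<lambda>k::nat. {x \<in> R C. real k *\<^sub>R u + x \<in> R C'})"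
    and "Y' = (\<lambda>k::nat. {y \<in> R C'. y - real k *\<^sub>R u \<in> R C})"
  have [measurable]: "Y k \<in> sets borel" "Y' k \<in> sets borel" for k
    unfolding Y_def Y'_def by measurable
  have line: thesis if "x \<in> R C"
    and *: "\<And>b b' t. (\<And>s. x + s *\<^sub>R u \<in> R C \<longleftrightarrow> b < s \<and> s \<le> b + 1) \<Longrightarrow>
      (\<And>s. x + s *\<^sub>R u \<in> R C' \<longleftrightarrow> b' < s \<and> s \<le> b' + 1) \<Longrightarrow> -1 \<le> b' \<Longrightarrow> thesis" for x thesis
  proof -
    obtain c l where l: "x = c + l *\<^sub>R u" "c \<in> C" "0 \<le> l" "l \<le> 1"
      using \<open>x \<in> R C\<close> by (auto simp: R_def set_plus_def in_segment)
    have "x + (-l) *\<^sub>R u \<in> C" using l by simp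
    moreover have "x + (-l) *\<^sub>R u \<in> C'" using sub l by auto
    ultimately obtain b b' where "\<And>s. x + s *\<^sub>R u \<in> R C \<longleftrightarrow> b < s \<and> s \<le> b + 1"
      "\<And>s. x + s *\<^sub>R u \<in> R C' \<longleftrightarrow> b' < s \<and> s \<le> b' + 1" "-l \<le> b'"
      unfolding R_def using swept_line_section[OF C u] swept_line_section[OF C' u] by metis
    then show thesis using l(4) by (intro *[of b b']) auto
  qed
  have "R C \<subseteq> (\<Union>k. Y k)"
  proof
    fix x assume x: "x \<in> R C"
    then show "x \<in> (\<Union>k. Y k)"
    proof (rule line)
      fix b b' :: real
      assume b': "\<And>s. x + s *\<^sub>R u \<in> R C' \<longleftrightarrow> b' < s \<and> s \<le> b' + 1" "-1 \<le> b'"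
      (* The only integer in the half-open interval from b' to b' + 1. *)
      define k where "k = nat (\<lfloor>b'\<rfloor> + 1)"
      have "real k = of_int \<lfloor>b'\<rfloor> + 1"
        using b'(2) unfolding k_def by linarith
      then have "b' < real k \<and> real k \<le> b' + 1" by linarith
      then have "x + real k *\<^sub>R u \<in> R C'" using b'(1) by simp
      then show "x \<in> (\<Union>k. Y k)" using x by (auto simp: Y_def add.commute)
    qed
  qed
  then have "emeasure lborel (R C) \<le> emeasure lborel (\<Union>k. Y k)"
    by (intro emeasure_mono) auto
  also have "\<dots> \<le> (\<Sum>k. emeasure lborel (Y k))"
    by (rule emeasure_subadditive_countably) auto
  also have "\<dots> = (\<Sum>k. emeasure lborel (Y' k))"
  proof -
    have "Y k = {x. real k *\<^sub>R u + x \<in> Y' k}" for k by (auto simp: Y_def Y'_def)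
    then show ?thesis by (simp add: emeasure_lborel_shift)
  qed
  also have "\<dots> = emeasure lborel (\<Union>k. Y' k)"
  proof (rule suminf_emeasure)
    have False if "y \<in> Y' j" "y \<in> Y' k" "j < k" for y j k
    proof -
      have "y - real k *\<^sub>R u \<in> R C" using that by (auto simp: Y'_def)
      then show False
      proof (rule line)
        fix b :: real
        assume b: "\<And>s. y - real k *\<^sub>R u + s *\<^sub>R u \<in> R C \<longleftrightarrow> b < s \<and> s \<le> b + 1"
        have "y - real k *\<^sub>R u + 0 *\<^sub>R u \<in> R C" "y - real k *\<^sub>R u + (real k - real j) *\<^sub>R u \<in> R C"
          using that by (auto simp: Y'_def algebra_simps)
        then have "b < 0" "real k - real j \<le> b + 1" using b by blast+
        moreover have "real k - real j \<ge> 1" using \<open>j < k\<close> by linarith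
        ultimately show False by linarith
      qed
    qed
    then show "disjoint_family Y'"
      by (auto simp: disjoint_family_on_def) (metis linorder_neqE_nat)
  qed auto
  also have "\<dots> \<le> emeasure lborel (R C')"
    by (intro emeasure_mono) (auto simp: Y'_def)
  finally show ?thesis by (simp add: R_def)
qed

abbreviation vol :: "'a::euclidean_space set \<Rightarrow> real" where
  "vol \<equiv> measure lebesgue"

lemma vol_mono:
  fixes A B :: "'a::euclidean_space set"
  shows "compact A \<Longrightarrow> compact B \<Longrightarrow> A \<subseteq> B \<Longrightarrow> vol A \<le> vol B"
  by (intro measure_mono_fmeasurable lmeasurable_compact) (auto intro: fmeasurableD lmeasurable_compact)

lemma vol_shift: "vol ({a} + A) = vol A"
proof -
  have "{a} + A = (+) a ` A" by (auto simp: set_plus_def)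
  then show ?thesis by (simp add: measure_translation)
qed

lemma vol_add_segment_mono:
  fixes C C' :: "'a::euclidean_space set"
  assumes C: "compact C" "convex C" and C': "compact C'" "convex C'" and sub: "C \<subseteq> C'"
  shows "vol (C + closed_segment 0 u) - vol C \<le> vol (C' + closed_segment 0 u) - vol C'"
proof (cases "u = 0")
  case False
  have eq: "vol (X + closed_segment 0 u) - vol X = measure lborel ((X + closed_segment 0 u) - X)"
    and fin: "emeasure lborel ((X + closed_segment 0 u) - X) < \<infinity>" if "compact X" for X :: "'a set"
  proof -
    have X: "compact (X + closed_segment 0 u)" using that by (intro compact_set_plus) auto
    have "X \<subseteq> X + closed_segment 0 u" by (metis ends_in_segment(1) set_zero_plus2 add.commute)
    then have "vol ((X + closed_segment 0 u) - X) = vol (X + closed_segment 0 u) - vol X"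
      using X that by (intro measurable_measure_Diff lmeasurable_compact) (auto intro: fmeasurableD lmeasurable_compact)
    then show "vol (X + closed_segment 0 u) - vol X = measure lborel ((X + closed_segment 0 u) - X)"
      using X that by (simp add: borel_compact measure_completion sets.Diff)
    have "emeasure lborel ((X + closed_segment 0 u) - X) \<le> emeasure lborel (X + closed_segment 0 u)"
      using X by (intro emeasure_mono) (auto simp: borel_compact)
    also have "\<dots> < \<infinity>" using emeasure_compact_finite[OF X] by simp
    finally show "emeasure lborel ((X + closed_segment 0 u) - X) < \<infinity>" .
  qed
  show ?thesis
    unfolding eq[OF C(1)] eq[OF C'(1)] unfolding measure_def
    using emeasure_swept_mono[OF C C' sub False] fin[OF C'(1)] by (intro enn2real_mono) auto
qed simp

definition zonotope :: "'a::euclidean_space list \<Rightarrow> 'a set" where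
  "zonotope vs = sum_list (map (\<lambda>v. closed_segment (- v) v) vs)"

lemma zonotope_simps [simp]:
  "zonotope [] = {0}" "zonotope (v # vs) = closed_segment (- v) v + zonotope vs"
  by (simp_all add: zonotope_def)

lemma symmetric_segment_shift:
  fixes u :: "'a::real_vector"
  shows "closed_segment (- u) u = {- u} + closed_segment 0 (2 *\<^sub>R u)"
proof -
  have "closed_segment (- u + 0) (- u + 2 *\<^sub>R u) = (+) (- u) ` closed_segment 0 (2 *\<^sub>R u)"
    by (rule closed_segment_translation)
  moreover have "- u + 2 *\<^sub>R u = u" by (simp add: scaleR_2)
  ultimately show ?thesis by (auto simp: set_plus_def)
qed

text \<open>
  Adding the segments of the zonotope one at a time, each step starts from two nested bodies again,
  so the inequalities for the single segments add up.
\<close>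
lemma vol_add_zonotope_mono:
  fixes C C' :: "'a::euclidean_space set"
  assumes "compact C" "convex C" "compact C'" "convex C'" "C \<subseteq> C'"
  shows "vol (C + zonotope vs) - vol C \<le> vol (C' + zonotope vs) - vol C'"
  using assms
proof (induction vs arbitrary: C C')
  case (Cons v vs)
  let ?I = "closed_segment (- v) v"
  have "vol (X + ?I) = vol (X + closed_segment 0 (2 *\<^sub>R v))" for X :: "'a set"
    unfolding symmetric_segment_shift[of v] by (metis add.left_commute vol_shift)
  then have "vol (C + ?I) - vol C \<le> vol (C' + ?I) - vol C'"
    using vol_add_segment_mono[OF Cons.prems] by simp
  moreover have "vol ((C + ?I) + zonotope vs) - vol (C + ?I) \<le> vol ((C' + ?I) + zonotope vs) - vol (C' + ?I)"
    using Cons.prems by (intro Cons.IH compact_set_plus convex_set_plus set_plus_mono2) auto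
  ultimately show ?case by (simp add: add.assoc)
qed simp

section \<open>Approximation of the ball by zonotopes\<close>

text \<open>
  Orthogonal images are controlled for compact sets only, whereas Lebesgue measure is characterised
  by its values on open boxes; the passage from closed to open boxes uses that the boundary of a box
  is compact and null.
\<close>
lemma distr_orthogonal:
  fixes f :: "real ^ 'n::finite \<Rightarrow> real ^ 'n"
  assumes f: "orthogonal_transformation f"
  shows "distr lborel borel f = lborel"
proof (rule sym, rule lborel_eqI)
  have [measurable]: "f \<in> borel_measurable borel"
    using f by (intro borel_measurable_continuous_onI linear_continuous_on linear_conv_bounded_linear[THEN iffD1] orthogonal_transformation_linear)
  have g: "orthogonal_transformation (inv f)" using f by (rule orthogonal_transformation_inv)
  have [measurable]: "inv f \<in> borel_measurable borel"
    using g by (intro borel_measurable_continuous_onI linear_continuous_on linear_conv_bounded_linear[THEN iffD1] orthogonal_transformation_linear)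
  have bij: "bij f" using f by (rule orthogonal_transformation_bij)
  have main: "measure lborel (f -` cbox l u) = measure lborel (cbox l u)" for l u
  proof -
    have "f -` cbox l u = inv f ` cbox l u" by (rule bij_vimage_eq_inv_image[OF bij])
    moreover have "compact (inv f ` cbox l u)"
      using g by (intro compact_linear_image orthogonal_transformation_linear) auto
    ultimately show ?thesis
      using measure_orthogonal_image_finite[OF g, of "cbox l u"] by (simp add: borel_compact)
  qed
  fix l u :: "real ^ 'n"
  assume lu: "\<And>b. b \<in> Basis \<Longrightarrow> l \<bullet> b \<le> u \<bullet> b"
  have null: "emeasure (distr lborel borel f) (cbox l u - box l u) = 0"
  proof -
    have "f -` (cbox l u - box l u) = inv f ` (cbox l u - box l u)" by (rule bij_vimage_eq_inv_image[OF bij])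
    moreover have "compact (cbox l u - box l u)"
      by (metis compact_cbox compact_diff open_box)
    moreover have "measure lebesgue (cbox l u - box l u) = 0"
      by (rule negligible_imp_measure0[OF negligible_frontier_interval])
    ultimately have "measure lebesgue (f -` (cbox l u - box l u)) = 0" "compact (f -` (cbox l u - box l u))"
      using measure_orthogonal_image_finite[OF g, of "cbox l u - box l u"] g
      by (auto intro: compact_linear_image orthogonal_transformation_linear)
    then have "emeasure lborel (f -` (cbox l u - box l u)) = 0"
      using emeasure_compact_finite[of "f -` (cbox l u - box l u)"]
      by (simp add: borel_compact emeasure_eq_ennreal_measure top.not_eq_extremum)
    then show ?thesis by (subst emeasure_distr) auto
  qed
  have "emeasure (distr lborel borel f) (cbox l u) = emeasure (distr lborel borel f) (box l u \<union> (cbox l u - box l u))"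
    using box_subset_cbox[of l u] by (simp add: Un_absorb1 Un_Diff_cancel)
  also have "\<dots> = emeasure (distr lborel borel f) (box l u)"
    by (rule emeasure_Un_null_set) (auto simp: null_sets_def null)
  finally have "emeasure (distr lborel borel f) (box l u) = emeasure lborel (f -` cbox l u)"
    by (subst (asm) emeasure_distr) auto
  also have "\<dots> = emeasure lborel (cbox l u)"
  proof -
    have "f -` cbox l u = inv f ` cbox l u" by (rule bij_vimage_eq_inv_image[OF bij])
    moreover have "compact (inv f ` cbox l u)"
      using g by (intro compact_linear_image orthogonal_transformation_linear) auto
    ultimately have "emeasure lborel (f -` cbox l u) \<noteq> \<infinity>"
      using emeasure_compact_finite[of "inv f ` cbox l u"] by auto
    then show ?thesis
      using main[of l u] emeasure_compact_finite[OF compact_cbox, of l u]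
      by (simp add: emeasure_eq_ennreal_measure)
  qed
  also have "\<dots> = (\<Prod>b\<in>Basis. (u - l) \<bullet> b)"
    using lu by (simp add: emeasure_lborel_cbox_eq)
  finally show "emeasure (distr lborel borel f) (box l u) = (\<Prod>b\<in>Basis. (u - l) \<bullet> b)" .
qed simp

lemma integrable_ball_abs_inner:
  fixes x :: "'a::euclidean_space"
  shows "integrable lborel (\<lambda>u. indicator (cball 0 1) u * \<bar>x \<bullet> u\<bar>)"
proof -
  have "integrable lborel (\<lambda>u. indicator (cball 0 1) u *\<^sub>R \<bar>x \<bullet> u\<bar>)"
    by (intro borel_integrable_compact) (auto intro!: continuous_intros)
  then show ?thesis by simp
qed

text \<open>
  The left-hand side is a rotation invariant and positively homogeneous function of \<open>x\<close>, hence a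
  multiple of the norm. The factor is not zero, since otherwise the ball would lie in a hyperplane up
  to a null set.
\<close>
lemma integral_ball_abs_inner:
  obtains c where "c > 0"
    "\<And>x :: real ^ 'n::finite. (\<integral>u. indicator (cball 0 1) u * \<bar>x \<bullet> u\<bar> \<partial>lborel) = c * norm x"
proof -
  define g where "g = (\<lambda>x :: real ^ 'n. \<integral>u. indicator (cball 0 1) u * \<bar>x \<bullet> u\<bar> \<partial>lborel)"
  obtain e :: "real ^ 'n" where e: "norm e = 1" using vector_choose_size[of 1] by auto
  have rot: "g (f x) = g x" if f: "orthogonal_transformation f" for f x
  proof -
    have [measurable]: "f \<in> borel_measurable borel"
      using f by (intro borel_measurable_continuous_onI linear_continuous_on linear_conv_bounded_linear[THEN iffD1] orthogonal_transformation_linear)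
    have m: "(\<lambda>u. indicator (cball 0 1) u * \<bar>f x \<bullet> u\<bar> :: real) \<in> borel_measurable borel"
      using borel_measurable_integrable[OF integrable_ball_abs_inner[of "f x"]] by simp
    have "g (f x) = (\<integral>u. indicator (cball 0 1) u * \<bar>f x \<bullet> u\<bar> \<partial>(distr lborel borel f))"
      by (simp add: g_def distr_orthogonal[OF f])
    also have "\<dots> = (\<integral>u. indicator (cball 0 1) (f u) * \<bar>f x \<bullet> f u\<bar> \<partial>lborel)"
      by (rule integral_distr[OF _ m]) measurable
    also have "\<dots> = g x"
      unfolding g_def using f
      by (intro Bochner_Integration.integral_cong)
        (auto simp: orthogonal_transformation_def[of f] orthogonal_transformation_norm[OF f] indicator_def)
    finally show ?thesis .
  qed
  have hom: "g x = g e * norm x" for x :: "real ^ 'n"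
  proof -
    obtain f where f: "orthogonal_transformation f" "f (norm x *\<^sub>R e) = x"
      using orthogonal_transformation_exists[of "norm x *\<^sub>R e" x] e by auto
    then have "g x = g (norm x *\<^sub>R e)" by (metis rot)
    also have "\<dots> = (\<integral>u. norm x * (indicator (cball 0 1) u * \<bar>e \<bullet> u\<bar>) \<partial>lborel)"
      unfolding g_def by (intro Bochner_Integration.integral_cong) (auto simp: abs_mult)
    also have "\<dots> = norm x * g e" unfolding g_def by simp
    finally show ?thesis by simp
  qed
  have "g e > 0"
  proof (rule ccontr)
    assume "\<not> g e > 0"
    moreover have "g e \<ge> 0" unfolding g_def by (intro Bochner_Integration.integral_nonneg) auto
    ultimately have "g e = 0" by simp
    then have "AE u in lborel. indicator (cball 0 1) u * \<bar>e \<bullet> u\<bar> = 0"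
      unfolding g_def by (subst (asm) integral_nonneg_eq_0_iff_AE) (auto intro: integrable_ball_abs_inner)
    then have ae: "AE u in lebesgue. indicator (cball 0 1) u * \<bar>e \<bullet> u\<bar> = 0"
      by (rule AE_completion)
    have "cball 0 1 - {u. e \<bullet> u = 0} \<in> null_sets lebesgue"
      using ae
    proof (subst AE_iff_null_sets)
      have "open (- {u. e \<bullet> u = 0})" using closed_hyperplane[of e 0] by (simp add: open_Compl)
      then have "cball 0 1 - {u. e \<bullet> u = 0} \<in> sets borel" by (simp add: sets.Diff closed_hyperplane)
      then show "cball 0 1 - {u. e \<bullet> u = 0} \<in> sets lebesgue" by simp
    qed (auto simp: indicator_def elim!: eventually_mono)
    then have "negligible (cball 0 1 - {u. e \<bullet> u = 0})" by (simp add: negligible_iff_null_sets)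
    moreover have "negligible {u. e \<bullet> u = 0}"
      using e by (intro negligible_hyperplane) auto
    ultimately have "negligible (cball (0 :: real ^ 'n) 1)"
      by (rule negligible_subset[OF negligible_Un]) auto
    then have "negligible (ball (0 :: real ^ 'n) 1)" by (rule negligible_subset) auto
    then show False using open_not_negligible[of "ball (0 :: real ^ 'n) 1"] by simp
  qed
  moreover have "(\<integral>u. indicator (cball 0 1) u * \<bar>x \<bullet> u\<bar> \<partial>lborel) = g e * norm x" for x :: "real ^ 'n"
    unfolding hom[of x, symmetric] by (simp only: g_def)
  ultimately show thesis by (rule that)
qed

text \<open>
  A piece of the ball within distance \<open>\<delta>\<close> of a point \<open>a\<close> contributes a single vector: \<open>a\<close> times the
  volume of the piece. The function \<open>u \<mapsto> \<bar>x \<bullet> u\<bar>\<close> is Lipschitz with constant \<open>norm x\<close>, so the error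
  is uniform in \<open>x\<close> after division by the norm.
\<close>
lemma abs_inner_riemann_sum:
  fixes k :: "'a::euclidean_space set"
  assumes "finite k" "Q \<in> sets borel" "Q \<subseteq> cball 0 1" "Q \<subseteq> (\<Union>a\<in>k. ball a \<delta>)"
  shows "\<exists>vs. \<forall>x. \<bar>(\<integral>u. indicator Q u * \<bar>x \<bullet> u\<bar> \<partial>lborel) - (\<Sum>v\<leftarrow>vs. \<bar>x \<bullet> v\<bar>)\<bar>
    \<le> \<delta> * norm x * measure lborel Q"
  using assms
proof (induction k arbitrary: Q rule: finite_induct)
  case empty
  then show ?case by (auto intro: exI[of _ "[]"])
next
  case (insert a k)
  have fin: "emeasure lborel P < \<infinity>" if "P \<subseteq> Q" "P \<in> sets borel" for P
    by (rule le_less_trans[OF emeasure_mono emeasure_compact_finite[OF compact_cball]])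
       (use that insert.prems in auto)
  have int: "integrable lborel (\<lambda>u. indicator P u * \<bar>x \<bullet> u\<bar>)" if "P \<subseteq> Q" "P \<in> sets borel" for P x
  proof (rule Bochner_Integration.integrable_bound[OF integrable_ball_abs_inner[of x]])
    show "(\<lambda>u. indicator P u * \<bar>x \<bullet> u\<bar>) \<in> borel_measurable lborel" using that by measurable
    show "AE u in lborel. norm (indicator P u * \<bar>x \<bullet> u\<bar>) \<le> norm (indicator (cball 0 1) u * \<bar>x \<bullet> u\<bar>)"
      using that insert.prems by (intro AE_I2) (auto simp: indicator_def)
  qed
  define P R where "P = Q \<inter> ball a \<delta>" and "R = Q - ball a \<delta>"
  have [measurable]: "P \<in> sets borel" "R \<in> sets borel" and sub: "P \<subseteq> Q" "R \<subseteq> Q"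
    using insert.prems by (auto simp: P_def R_def)
  have "R \<subseteq> (\<Union>a\<in>k. ball a \<delta>)" using insert.prems by (auto simp: R_def)
  then obtain vs where vs: "\<And>x. \<bar>(\<integral>u. indicator R u * \<bar>x \<bullet> u\<bar> \<partial>lborel) - (\<Sum>v\<leftarrow>vs. \<bar>x \<bullet> v\<bar>)\<bar>
    \<le> \<delta> * norm x * measure lborel R"
    using insert.IH[of R] sub insert.prems(2) \<open>R \<in> sets borel\<close> by (meson subset_trans)
  define m where "m = measure lborel P"
  have first: "\<bar>(\<integral>u. indicator P u * \<bar>x \<bullet> u\<bar> \<partial>lborel) - \<bar>x \<bullet> (m *\<^sub>R a)\<bar>\<bar> \<le> \<delta> * norm x * m" for x
  proof -
    have iP: "integrable lborel (\<lambda>u. indicator P u :: real)"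
      using fin[OF sub(1)] by (simp add: integrable_indicator_iff)
    have "m * y = (\<integral>u. indicator P u * y \<partial>lborel)" for y
      using fin[OF sub(1)] by (simp add: m_def)
    moreover have "\<bar>x \<bullet> (m *\<^sub>R a)\<bar> = m * \<bar>x \<bullet> a\<bar>" by (simp add: m_def abs_mult)
    ultimately have "(\<integral>u. indicator P u * \<bar>x \<bullet> u\<bar> \<partial>lborel) - \<bar>x \<bullet> (m *\<^sub>R a)\<bar>
      = (\<integral>u. indicator P u * \<bar>x \<bullet> u\<bar> - indicator P u * \<bar>x \<bullet> a\<bar> \<partial>lborel)"
      using int[OF sub(1)] iP by (subst Bochner_Integration.integral_diff) auto
    also have "\<bar>\<dots>\<bar> \<le> (\<integral>u. \<bar>indicator P u * \<bar>x \<bullet> u\<bar> - indicator P u * \<bar>x \<bullet> a\<bar>\<bar> \<partial>lborel)"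
      by (rule integral_abs_bound)
    also have "\<dots> \<le> (\<integral>u. indicator P u * (\<delta> * norm x) \<partial>lborel)"
    proof (rule integral_mono)
      show "integrable lborel (\<lambda>u. \<bar>indicator P u * \<bar>x \<bullet> u\<bar> - indicator P u * \<bar>x \<bullet> a\<bar>\<bar>)"
        using int[OF sub(1)] iP by (intro integrable_abs Bochner_Integration.integrable_diff) auto
      show "integrable lborel (\<lambda>u. indicator P u * (\<delta> * norm x))" using iP by auto
      fix u
      have "\<bar>\<bar>x \<bullet> u\<bar> - \<bar>x \<bullet> a\<bar>\<bar> \<le> \<delta> * norm x" if "u \<in> P"
      proof -
        have "\<bar>\<bar>x \<bullet> u\<bar> - \<bar>x \<bullet> a\<bar>\<bar> \<le> \<bar>x \<bullet> (u - a)\<bar>" by (simp add: inner_diff_right)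
        also have "\<dots> \<le> norm x * norm (u - a)" by (rule Cauchy_Schwarz_ineq2)
        also have "\<dots> \<le> norm x * \<delta>"
          using that by (intro mult_left_mono) (auto simp: P_def dist_norm norm_minus_commute)
        finally show ?thesis by (simp add: mult.commute)
      qed
      then show "\<bar>indicator P u * \<bar>x \<bullet> u\<bar> - indicator P u * \<bar>x \<bullet> a\<bar>\<bar> \<le> indicator P u * (\<delta> * norm x)"
        by (auto simp: indicator_def)
    qed
    also have "\<dots> = \<delta> * norm x * m" by (simp add: m_def mult.commute)
    finally show ?thesis .
  qed
  have "\<bar>(\<integral>u. indicator Q u * \<bar>x \<bullet> u\<bar> \<partial>lborel) - (\<Sum>v\<leftarrow>m *\<^sub>R a # vs. \<bar>x \<bullet> v\<bar>)\<bar>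
    \<le> \<delta> * norm x * measure lborel Q" for x
  proof -
    have "(\<integral>u. indicator Q u * \<bar>x \<bullet> u\<bar> \<partial>lborel)
      = (\<integral>u. indicator P u * \<bar>x \<bullet> u\<bar> + indicator R u * \<bar>x \<bullet> u\<bar> \<partial>lborel)"
      by (intro Bochner_Integration.integral_cong) (auto simp: indicator_def P_def R_def)
    also have "\<dots> = (\<integral>u. indicator P u * \<bar>x \<bullet> u\<bar> \<partial>lborel) + (\<integral>u. indicator R u * \<bar>x \<bullet> u\<bar> \<partial>lborel)"
      using int sub by (intro Bochner_Integration.integral_add) auto
    finally have 1: "(\<integral>u. indicator Q u * \<bar>x \<bullet> u\<bar> \<partial>lborel) = \<dots>" .
    have "Q = P \<union> R" "P \<inter> R = {}" by (auto simp: P_def R_def)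
    then have "measure lborel Q = m + measure lborel R"
      using fin sub unfolding m_def by (metis measure_Union infinity_ennreal_def less_irrefl sets_lborel \<open>P \<in> sets borel\<close> \<open>R \<in> sets borel\<close>)
    then have 2: "\<delta> * norm x * measure lborel Q = \<delta> * norm x * m + \<delta> * norm x * measure lborel R"
      by (simp add: algebra_simps)
    show ?thesis
      using first[of x] vs[of x] unfolding 1 2 by simp
  qed
  then show ?case by blast
qed

lemma norm_approx_by_segments:
  assumes "\<eta> > 0"
  obtains vs :: "(real ^ 'n::finite) list" where
    "\<And>x. norm x \<le> (\<Sum>v\<leftarrow>vs. \<bar>x \<bullet> v\<bar>)" "\<And>x. (\<Sum>v\<leftarrow>vs. \<bar>x \<bullet> v\<bar>) \<le> (1 + \<eta>) * norm x"
proof -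
  \<comment> \<open>Chosen so that \<open>(1 + \<epsilon>) / (1 - \<epsilon>) = 1 + \<eta>\<close>: a two-sided relative error \<open>\<epsilon>\<close> becomes a one-sided
    error \<open>\<eta>\<close> after rescaling by \<open>1 - \<epsilon>\<close>.\<close>
  define \<epsilon> where "\<epsilon> = \<eta> / (2 + \<eta>)"
  have \<epsilon>: "\<epsilon> > 0" "1 - \<epsilon> > 0" "1 + \<epsilon> = (1 - \<epsilon>) * (1 + \<eta>)"
    using assms by (auto simp: \<epsilon>_def field_simps)
  obtain c where c: "c > 0"
    "\<And>x :: real ^ 'n. (\<integral>u. indicator (cball 0 1) u * \<bar>x \<bullet> u\<bar> \<partial>lborel) = c * norm x"
    using integral_ball_abs_inner by blast
  define m where "m = measure lborel (cball 0 1 :: (real ^ 'n) set) + 1"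
  have m: "m \<ge> 1" by (simp add: m_def)
  define \<delta> where "\<delta> = \<epsilon> * c / m"
  have "\<delta> > 0" using \<epsilon> c m by (simp add: \<delta>_def)
  then obtain k where "finite k" "cball (0 :: real ^ 'n) 1 \<subseteq> (\<Union>a\<in>k. ball a \<delta>)"
    using seq_compact_imp_totally_bounded[of "cball (0 :: real ^ 'n) 1"] compact_cball
    by (metis compact_eq_seq_compact_metric)
  then obtain vs where vs: "\<And>x :: real ^ 'n. \<bar>c * norm x - (\<Sum>v\<leftarrow>vs. \<bar>x \<bullet> v\<bar>)\<bar>
      \<le> \<delta> * norm x * measure lborel (cball 0 1 :: (real ^ 'n) set)"
    using abs_inner_riemann_sum[of k "cball 0 1" \<delta>] c(2) by auto
  have close: "\<bar>c * norm x - (\<Sum>v\<leftarrow>vs. \<bar>x \<bullet> v\<bar>)\<bar> \<le> \<epsilon> * (c * norm x)" for x :: "real ^ 'n"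
  proof -
    have "\<delta> * norm x * measure lborel (cball 0 1 :: (real ^ 'n) set) \<le> \<delta> * norm x * m"
      using \<open>\<delta> > 0\<close> by (intro mult_left_mono) (auto simp: m_def)
    also have "\<dots> = \<epsilon> * (c * norm x)" using m by (simp add: \<delta>_def)
    finally show ?thesis using vs[of x] by linarith
  qed
  define d where "d = c * (1 - \<epsilon>)"
  have "d > 0" using c \<epsilon> by (simp add: d_def)
  have sum: "(\<Sum>v\<leftarrow>map ((*\<^sub>R) (1 / d)) vs. \<bar>x \<bullet> v\<bar>) = (\<Sum>v\<leftarrow>vs. \<bar>x \<bullet> v\<bar>) / d" for x :: "real ^ 'n"
    using \<open>d > 0\<close> by (induction vs) (auto simp: abs_mult add_divide_distrib)
  show thesis
  proof (rule that[of "map ((*\<^sub>R) (1 / d)) vs"]; unfold sum)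
    fix x :: "real ^ 'n"
    have "d * norm x = c * norm x - \<epsilon> * (c * norm x)" by (simp add: d_def algebra_simps)
    then have "d * norm x \<le> (\<Sum>v\<leftarrow>vs. \<bar>x \<bullet> v\<bar>)" using close[of x] by linarith
    then show "norm x \<le> (\<Sum>v\<leftarrow>vs. \<bar>x \<bullet> v\<bar>) / d" using \<open>d > 0\<close> by (simp add: field_simps)
    have "d * (1 + \<eta>) * norm x = c * norm x + \<epsilon> * (c * norm x)"
      using arg_cong[OF \<epsilon>(3), of "\<lambda>y. y * (c * norm x)"] by (simp add: d_def algebra_simps)
    then have "(\<Sum>v\<leftarrow>vs. \<bar>x \<bullet> v\<bar>) \<le> d * (1 + \<eta>) * norm x" using close[of x] by linarith
    then show "(\<Sum>v\<leftarrow>vs. \<bar>x \<bullet> v\<bar>) / d \<le> (1 + \<eta>) * norm x" using \<open>d > 0\<close> by (simp add: field_simps)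
  qed
qed


lemma compact_zonotope: "compact (zonotope vs)"
  by (induction vs) (auto intro!: compact_set_plus)

lemma convex_zonotope: "convex (zonotope vs)"
  by (induction vs) (auto intro!: convex_set_plus)

lemma linear_image_set_plus: "linear f \<Longrightarrow> f ` (A + B) = f ` A + f ` B"
  by (auto simp: set_plus_def image_iff linear_add; metis linear_add)

lemma linear_image_zonotope: "linear f \<Longrightarrow> f ` zonotope vs = zonotope (map f vs)"
  by (induction vs)
    (simp_all add: linear_image_set_plus linear_0 linear_neg closed_segment_linear_image[symmetric])

text \<open>
  The next two lemmas compute the support function of a zonotope: the supremum of \<open>x \<bullet> z\<close> is the sum
  below, and by central symmetry its negative is attained as well.
\<close>
lemma zonotope_inner_le: "z \<in> zonotope vs \<Longrightarrow> x \<bullet> z \<le> (\<Sum>v\<leftarrow>vs. \<bar>x \<bullet> v\<bar>)"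
proof (induction vs arbitrary: z)
  case (Cons v vs)
  then obtain y w where z: "z = y + w" "y \<in> closed_segment (- v) v" "w \<in> zonotope vs"
    by (auto simp: set_plus_def)
  then obtain s where s: "0 \<le> s" "s \<le> 1" "y = (1 - s) *\<^sub>R (- v) + s *\<^sub>R v"
    by (auto simp: in_segment)
  have "x \<bullet> y = (2 * s - 1) * (x \<bullet> v)" by (simp add: s inner_right_distrib algebra_simps)
  also have "\<dots> \<le> \<bar>2 * s - 1\<bar> * \<bar>x \<bullet> v\<bar>" by (metis abs_ge_self abs_mult)
  also have "\<dots> \<le> 1 * \<bar>x \<bullet> v\<bar>" using s by (intro mult_right_mono) auto
  finally show ?case using Cons.IH[OF z(3)] by (simp add: z inner_right_distrib)
qed simp

lemma zonotope_extreme: "\<exists>z\<in>zonotope vs. x \<bullet> z = - (\<Sum>v\<leftarrow>vs. \<bar>x \<bullet> v\<bar>)"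
proof (induction vs)
  case (Cons v vs)
  then obtain z where z: "z \<in> zonotope vs" "x \<bullet> z = - (\<Sum>v\<leftarrow>vs. \<bar>x \<bullet> v\<bar>)" by blast
  define y where "y = (if x \<bullet> v \<ge> 0 then - v else v)"
  have "y \<in> closed_segment (- v) v" by (simp add: y_def)
  then have "y + z \<in> zonotope (v # vs)" using z by (simp add: set_plus_intro)
  moreover have "x \<bullet> (y + z) = - (\<Sum>v\<leftarrow>v # vs. \<bar>x \<bullet> v\<bar>)"
    using z by (simp add: y_def inner_right_distrib)
  ultimately show ?case by blast
qed simp

text \<open>
  Inclusions between compact convex sets are inequalities between support functions. That the ball
  lies in the zonotope comes from separating a point outside the zonotope by a hyperplane.
\<close>
lemma ball_approx_by_zonotope:
  assumes "\<eta> > 0"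
  obtains vs :: "(real ^ 'n::finite) list" where
    "cball 0 1 \<subseteq> zonotope vs" "zonotope vs \<subseteq> cball 0 (1 + \<eta>)"
proof -
  obtain vs :: "(real ^ 'n) list" where vs:
    "\<And>x. norm x \<le> (\<Sum>v\<leftarrow>vs. \<bar>x \<bullet> v\<bar>)" "\<And>x. (\<Sum>v\<leftarrow>vs. \<bar>x \<bullet> v\<bar>) \<le> (1 + \<eta>) * norm x"
    using norm_approx_by_segments[OF assms] by blast
  show thesis
  proof (rule that[of vs]; rule subsetI)
    fix z assume "z \<in> zonotope vs"
    then have "z \<bullet> z \<le> (1 + \<eta>) * norm z"
      using zonotope_inner_le[of z vs z] vs(2)[of z] by linarith
    then have "norm z * norm z \<le> (1 + \<eta>) * norm z"
      by (simp add: dot_square_norm power2_eq_square)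
    then have "norm z \<le> 1 + \<eta>"
      using assms by (cases "z = 0") auto
    then show "z \<in> cball 0 (1 + \<eta>)" by simp
  next
    fix x :: "real ^ 'n" assume x: "x \<in> cball 0 1"
    show "x \<in> zonotope vs"
    proof (rule ccontr)
      assume "x \<notin> zonotope vs"
      then obtain a b where ab: "a \<bullet> x < b" "\<forall>z\<in>zonotope vs. b < a \<bullet> z"
        using separating_hyperplane_closed_point[of "zonotope vs" x] convex_zonotope compact_zonotope
        by (metis compact_imp_closed)
      obtain z where "z \<in> zonotope vs" "a \<bullet> z = - (\<Sum>v\<leftarrow>vs. \<bar>a \<bullet> v\<bar>)"
        using zonotope_extreme by blast
      with ab vs(1)[of a] have "norm a < - (a \<bullet> x)" by fastforce
      also have "\<dots> \<le> norm a * norm x" by (metis abs_ge_minus_self Cauchy_Schwarz_ineq2 order_trans)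
      also have "\<dots> \<le> norm a * 1" using x by (intro mult_left_mono) auto
      finally show False by simp
    qed
  qed
qed

section \<open>Growth of volume under addition of a ball\<close>

text \<open>
  A compact set has open neighbourhoods of almost the same volume, and one of them contains a whole
  \<open>\<delta>\<close>-neighbourhood. This makes the volume of the parallel bodies continuous from the right.
\<close>
lemma vol_thicken:
  fixes X :: "'a::euclidean_space set"
  assumes X: "compact X" and "e > 0"
  obtains \<delta> where "\<delta> > 0" "vol (X + cball 0 \<delta>) < vol X + e"
proof -
  obtain T where T: "open T" "X \<subseteq> T" "(T - X) \<in> lmeasurable" "emeasure lebesgue (T - X) < ennreal e"
    using sets_lebesgue_outer_open[of X e] X \<open>e > 0\<close> by (metis fmeasurableD lmeasurable_compact)
  obtain \<delta> where \<delta>: "\<delta> > 0" "(\<Union>x\<in>X. cball x \<delta>) \<subseteq> T"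
    using compact_subset_open_imp_cball_epsilon_subset[OF X T(1,2)] by blast
  have "X + cball 0 \<delta> \<subseteq> (\<Union>x\<in>X. cball x \<delta>)"
    by (auto simp: set_plus_def dist_norm)
  then have sub: "(X + cball 0 \<delta>) - X \<subseteq> T - X" using \<delta> by blast
  have c: "compact (X + cball 0 \<delta>)" using X by (intro compact_set_plus) auto
  have "0 \<in> cball (0::'a) \<delta>" using \<delta> by simp
  then have "X \<subseteq> X + cball 0 \<delta>" by (metis set_zero_plus2 add.commute)
  then have "vol (X + cball 0 \<delta>) - vol X = vol ((X + cball 0 \<delta>) - X)"
    using c X by (intro measurable_measure_Diff[symmetric] lmeasurable_compact) (auto intro: fmeasurableD lmeasurable_compact)
  also have "\<dots> \<le> measure lebesgue (T - X)"
    using sub c X T by (intro measure_mono_fmeasurable) (auto intro: fmeasurableD lmeasurable_compact)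
  also have "\<dots> < e"
    using T(3,4) \<open>e > 0\<close> by (simp add: emeasure_eq_measure2 ennreal_less_iff)
  finally show thesis using that \<delta>(1) by simp
qed

lemma cball_plus_cball:
  fixes s t :: real
  assumes "s \<ge> 0" "t \<ge> 0"
  shows "cball (0::'a::euclidean_space) s + cball 0 t = cball 0 (s + t)"
proof (intro equalityI subsetI)
  fix x :: 'a assume x: "x \<in> cball 0 (s + t)"
  show "x \<in> cball 0 s + cball 0 t"
  proof (cases "s + t = 0")
    case True
    with assms have "s = 0" "t = 0" by auto
    then show ?thesis using x by (auto simp: set_plus_def)
  next
    case False
    with assms have "s + t > 0" by auto
    define y z where "y = (s / (s + t)) *\<^sub>R x" and "z = (t / (s + t)) *\<^sub>R x"
    have "y + z = x" using \<open>s + t > 0\<close> by (simp add: y_def z_def scaleR_add_left[symmetric] add_divide_distrib[symmetric])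
    moreover have "norm y \<le> s" "norm z \<le> t"
      using assms x \<open>s + t > 0\<close> mult_left_mono[of "norm x" "s + t" s] mult_left_mono[of "norm x" "s + t" t]
      by (auto simp: y_def z_def field_simps)
    ultimately show ?thesis by (metis set_plus_intro mem_cball_0)
  qed
next
  fix x :: 'a assume "x \<in> cball 0 s + cball 0 t"
  then obtain y z where "x = y + z" "norm y \<le> s" "norm z \<le> t" by (auto simp: set_plus_def)
  then show "x \<in> cball 0 (s + t)" using norm_triangle_ineq[of y z] by simp
qed

lemma vol_thicken_linear:
  fixes P :: "real ^ 'n::finite \<Rightarrow> real ^ 'n"
  assumes X: "compact X" and P: "linear P" and "e > 0" "t \<ge> 0"
  obtains \<delta> where "\<delta> > 0" "\<And>d. 0 \<le> d \<Longrightarrow> d \<le> \<delta> \<Longrightarrow> vol (X + P ` cball 0 (t + d)) < vol (X + P ` cball 0 t) + e"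
proof -
  define Y where "Y = X + P ` cball 0 t"
  have Y: "compact Y" unfolding Y_def using X P by (intro compact_set_plus compact_linear_image) auto
  obtain \<delta> where \<delta>: "\<delta> > 0" "vol (Y + cball 0 \<delta>) < vol Y + e"
    using vol_thicken[OF Y \<open>e > 0\<close>] by blast
  obtain B where B: "B > 0" "\<And>x. norm (P x) \<le> B * norm x"
    using linear_bounded_pos[OF P] by blast
  show thesis
  proof (rule that[of "\<delta> / B"])
    show "\<delta> / B > 0" using \<delta> B by simp
    fix d assume d: "0 \<le> d" "d \<le> \<delta> / B"
    have "P ` cball 0 d \<subseteq> cball 0 \<delta>"
    proof safe
      fix x :: "real ^ 'n" assume "x \<in> cball 0 d"
      then have "B * norm x \<le> B * d" using B by simp
      also have "\<dots> \<le> \<delta>" using d B by (simp add: field_simps)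
      finally show "P x \<in> cball 0 \<delta>" using B(2)[of x] by simp
    qed
    moreover have "X + P ` cball 0 (t + d) = Y + P ` cball 0 d"
      using d \<open>t \<ge> 0\<close> by (simp add: Y_def cball_plus_cball[symmetric] linear_image_set_plus[OF P] add.assoc)
    ultimately have "X + P ` cball 0 (t + d) \<subseteq> Y + cball 0 \<delta>" by (simp add: set_plus_mono2)
    then have "vol (X + P ` cball 0 (t + d)) \<le> vol (Y + cball 0 \<delta>)"
      using X Y P by (intro vol_mono compact_set_plus compact_linear_image) auto
    then show "vol (X + P ` cball 0 (t + d)) < vol (X + P ` cball 0 t) + e"
      using \<delta>(2) by (simp add: Y_def)
  qed
qed

text \<open>
  The image of the ball under \<open>P\<close> is squeezed between images of zonotopes, which are zonotopes. The
  outer approximation appears only on the larger body, where its excess is absorbed by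
  \<open>vol_thicken_linear\<close>. A general linear map \<open>P\<close> covers both the ball itself and its projection to a
  hyperplane.
\<close>
lemma vol_add_ball_mono:
  fixes C C' :: "(real ^ 'n::finite) set" and P :: "real ^ 'n \<Rightarrow> real ^ 'n"
  assumes C: "compact C" "convex C" and C': "compact C'" "convex C'" and sub: "C \<subseteq> C'"
    and P: "linear P" and "t \<ge> 0"
  shows "vol (C + P ` cball 0 t) - vol C \<le> vol (C' + P ` cball 0 t) - vol C'"
proof (rule field_le_epsilon)
  fix e :: real assume "e > 0"
  obtain \<delta> where \<delta>: "\<delta> > 0"
    "\<And>d. 0 \<le> d \<Longrightarrow> d \<le> \<delta> \<Longrightarrow> vol (C' + P ` cball 0 (t + d)) < vol (C' + P ` cball 0 t) + e"
    using vol_thicken_linear[OF C'(1) P \<open>e > 0\<close> \<open>t \<ge> 0\<close>] by blast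
  define \<eta> where "\<eta> = \<delta> / (t + 1)"
  have \<eta>: "\<eta> > 0" "t * \<eta> \<le> \<delta>" using \<delta> \<open>t \<ge> 0\<close> by (auto simp: \<eta>_def field_simps)
  obtain vs :: "(real ^ 'n) list" where vs: "cball 0 1 \<subseteq> zonotope vs" "zonotope vs \<subseteq> cball 0 (1 + \<eta>)"
    using ball_approx_by_zonotope[OF \<eta>(1)] by blast
  define Z where "Z = zonotope (map (\<lambda>v. P (t *\<^sub>R v)) vs)"
  have lin: "linear (\<lambda>v. P (t *\<^sub>R v))"
    using P by (auto intro!: linearI simp: linear_add linear_cmul algebra_simps)
  have Z: "Z = (\<lambda>v. P (t *\<^sub>R v)) ` zonotope vs"
    unfolding Z_def by (rule linear_image_zonotope[OF lin, symmetric])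
  have scale: "(\<lambda>v. P (t *\<^sub>R v)) ` cball 0 s = P ` cball 0 (t * s)" if "s > 0" for s
  proof -
    have "(*\<^sub>R) t ` cball (0 :: real ^ 'n) s = cball 0 (t * s)"
    proof (cases "t = 0")
      case True
      have "cball (0 :: real ^ 'n) s \<noteq> {}" using that by simp
      then show ?thesis using True by (simp add: image_constant_conv)
    qed (use cball_scale[of t 0 s] \<open>t \<ge> 0\<close> in simp)
    moreover have "(\<lambda>v. P (t *\<^sub>R v)) ` cball 0 s = P ` ((*\<^sub>R) t ` cball 0 s)"
      by (simp only: image_image)
    ultimately show ?thesis by simp
  qed
  have "(\<lambda>v. P (t *\<^sub>R v)) ` cball 0 1 \<subseteq> Z" "Z \<subseteq> (\<lambda>v. P (t *\<^sub>R v)) ` cball 0 (1 + \<eta>)"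
    unfolding Z by (intro image_mono vs)+
  then have "P ` cball 0 t \<subseteq> Z" "Z \<subseteq> P ` cball 0 (t + t * \<eta>)"
    using scale[of 1] scale[of "1 + \<eta>"] \<eta> by (simp_all add: distrib_left)
  moreover have "compact Z" "compact (P ` cball 0 s)" for s
    using P by (simp_all add: Z_def compact_zonotope compact_linear_image)
  ultimately have 1: "vol (C + P ` cball 0 t) \<le> vol (C + Z)" and 2: "vol (C' + Z) \<le> vol (C' + P ` cball 0 (t + t * \<eta>))"
    using C(1) C'(1) by (simp_all add: vol_mono compact_set_plus set_plus_mono2)
  have "vol (C + Z) - vol C \<le> vol (C' + Z) - vol C'"
    unfolding Z_def by (rule vol_add_zonotope_mono) fact+
  then show "vol (C + P ` cball 0 t) - vol C \<le> vol (C' + P ` cball 0 t) - vol C' + e"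
    using 1 2 \<delta>(2)[of "t * \<eta>"] \<eta> \<open>t \<ge> 0\<close> by simp
qed

text \<open>
  The continuous-parameter form of Fekete's lemma, at zero: if \<open>s\<close> fits \<open>N\<close> times into \<open>t\<close>, then
  \<open>N \<phi>(s) \<le> \<phi>(t)\<close>, and \<open>N s > t - s\<close>. So small arguments have a quotient at most slightly larger than
  that of any fixed \<open>t\<close>, and the limit is the infimum.
\<close>
lemma superadditive_quotient_tendsto:
  fixes \<phi> :: "real \<Rightarrow> real"
  assumes nonneg: "\<And>t. t > 0 \<Longrightarrow> \<phi> t \<ge> 0"
    and super: "\<And>s t. s > 0 \<Longrightarrow> t > 0 \<Longrightarrow> \<phi> s + \<phi> t \<le> \<phi> (s + t)"
  obtains L where "((\<lambda>t. \<phi> t / t) \<longlongrightarrow> L) (at_right 0)" "\<And>t. t > 0 \<Longrightarrow> L \<le> \<phi> t / t"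
proof -
  define L where "L = (INF t\<in>{0<..}. \<phi> t / t)"
  have bdd: "bdd_below ((\<lambda>t. \<phi> t / t) ` {0<..})"
    using nonneg by (auto intro!: bdd_belowI2[of _ 0])
  have L: "L \<le> \<phi> t / t" if "t > 0" for t
    unfolding L_def using that by (intro cINF_lower bdd) auto
  have iterate: "real (Suc k) * \<phi> s \<le> \<phi> (real (Suc k) * s)" if "s > 0" for k s
  proof (induction k)
    case (Suc k)
    have "\<phi> (real (Suc k) * s) + \<phi> s \<le> \<phi> (real (Suc k) * s + s)"
      using that by (intro super) auto
    with Suc show ?case by (simp add: algebra_simps)
  qed simp
  have upper: "\<phi> s / s \<le> \<phi> t / (t - s)" if "0 < s" "s < t" for s t
  proof -
    define k where "k = nat (\<lfloor>t / s\<rfloor> - 1)"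
    have ts: "t / s > 1" using that by simp
    then have k: "real (Suc k) = of_int \<lfloor>t / s\<rfloor>" unfolding k_def by linarith
    define N where "N = real (Suc k)"
    have N: "N > 0" "N \<le> t / s" "t / s < N + 1" using k unfolding N_def by linarith+
    have le: "N * s \<le> t" and gt: "t - s < N * s"
      using N(2,3) that(1) by (simp_all add: field_simps)
    have "\<phi> (N * s) \<le> \<phi> t"
    proof (cases "N * s = t")
      case False
      then have "\<phi> (N * s) + \<phi> (t - N * s) \<le> \<phi> (N * s + (t - N * s))"
        using le that N(1) by (intro super) auto
      moreover have "\<phi> (t - N * s) \<ge> 0" using le False by (intro nonneg) auto
      ultimately show ?thesis by simp
    qed simp
    then have *: "N * \<phi> s \<le> \<phi> t" using iterate[OF that(1), of k] unfolding N_def by linarith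
    have "\<phi> s * (t - s) \<le> \<phi> s * (N * s)"
      using gt nonneg[OF that(1)] by (intro mult_left_mono) auto
    also have "\<dots> \<le> \<phi> t * s" using mult_right_mono[OF *, of s] that by (simp add: mult_ac)
    finally show ?thesis using that by (simp add: field_simps)
  qed
  have "((\<lambda>t. \<phi> t / t) \<longlongrightarrow> L) (at_right 0)"
  proof (rule order_tendstoI)
    fix a assume "a < L"
    show "\<forall>\<^sub>F t in at_right 0. a < \<phi> t / t"
      using eventually_at_right_less[of "0::real"] by eventually_elim (use L \<open>a < L\<close> in force)
  next
    fix a assume "L < a"
    then obtain t where t: "t > 0" "\<phi> t / t < a"
      unfolding L_def using cInf_lessD[of "(\<lambda>t. \<phi> t / t) ` {0<..}" a] by auto
    have "((\<lambda>s. \<phi> t / (t - s)) \<longlongrightarrow> \<phi> t / (t - 0)) (at_right 0)"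
      using t by (intro tendsto_intros) auto
    then have "\<forall>\<^sub>F s in at_right 0. \<phi> t / (t - s) < a"
      using t by (intro order_tendstoD) auto
    moreover have "\<forall>\<^sub>F s in at_right 0. s \<in> {0<..<t}"
      using t by (intro eventually_at_right_real) auto
    ultimately show "\<forall>\<^sub>F s in at_right 0. \<phi> s / s < a"
      by eventually_elim (use upper in force)
  qed
  then show thesis using that L by blast
qed

section \<open>Lebesgue measure on a hyperplane\<close>

lemma borel_measurable_linear:
  fixes f :: "'a::euclidean_space \<Rightarrow> 'b::euclidean_space"
  shows "linear f \<Longrightarrow> f \<in> borel_measurable borel"
  by (intro borel_measurable_continuous_onI linear_continuous_on linear_conv_bounded_linear[THEN iffD1])

lemma orthonormal_basis_of_inner:
  "orthonormal_basis_of E B \<Longrightarrow> b \<in> B \<Longrightarrow> c \<in> B \<Longrightarrow> b \<bullet> c = (if b = c then 1 else 0)"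
  by (auto simp: orthonormal_basis_of_def pairwise_def orthogonal_def norm_eq_1)

lemma orthonormal_basis_of_independent:
  "orthonormal_basis_of E B \<Longrightarrow> independent B"
  by (rule pairwise_orthogonal_independent) (auto simp: orthonormal_basis_of_def)

lemma orthonormal_basis_of_finite:
  "orthonormal_basis_of E B \<Longrightarrow> finite B"
  using orthonormal_basis_of_independent independent_imp_finite by blast

text \<open>
  A bijection between the standard basis and \<open>B\<close> splits the coordinate map into the standard one,
  after renaming of coordinates, and the orthogonal map that sends the standard basis to \<open>B\<close>.
\<close>
lemma lborel_orthonormal_coordinates:
  fixes B :: "(real ^ 'n::finite) set"
  assumes B: "orthonormal_basis_of UNIV B"
  shows "distr (\<Pi>\<^sub>M b\<in>B. (lborel :: real measure)) borel (\<lambda>f. \<Sum>b\<in>B. f b *\<^sub>R b) = lborel"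
proof -
  note fin = orthonormal_basis_of_finite[OF B]
  have "card B = dim (span B)"
    using orthonormal_basis_of_independent[OF B] by (metis dim_span dim_eq_card_independent)
  also have "span B = UNIV" using B by (simp add: orthonormal_basis_of_def)
  finally have "card B = card (Basis :: (real ^ 'n) set)" by (simp only: dim_UNIV)
  then obtain h where h: "bij_betw h (Basis :: (real ^ 'n) set) B"
    using finite_same_card_bij[OF finite_Basis fin] by metis
  define g where "g = inv_into Basis h"
  have g: "bij_betw g B Basis" unfolding g_def using h by (rule bij_betw_inv_into)
  have hg: "h (g b) = b" if "b \<in> B" for b
    using that h by (auto simp: g_def bij_betw_inv_into_right)
  have gh: "g (h i) = i" if "i \<in> Basis" for i
    using that h by (auto simp: g_def bij_betw_inv_into_left)
  have hB: "h i \<in> B" if "i \<in> Basis" for i using that h by (auto simp: bij_betw_def)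
  have gB: "g b \<in> Basis" if "b \<in> B" for b using that g by (auto simp: bij_betw_def)
  interpret product_sigma_finite "\<lambda>_ :: real ^ 'n. (lborel :: real measure)" ..
  let ?M = "\<Pi>\<^sub>M b\<in>B. (lborel :: real measure)"
  have coord: "(\<Sum>b\<in>B. f b *\<^sub>R g b) \<bullet> i = f (h i)" if "i \<in> Basis" for f i
  proof -
    have "(\<Sum>b\<in>B. f b *\<^sub>R g b) \<bullet> i = (\<Sum>b\<in>B. if b = h i then f b else 0)"
      unfolding inner_sum_left
      by (intro sum.cong) (use that gB gh hg in \<open>auto simp: inner_Basis\<close>)
    then show ?thesis using fin hB[OF that] by simp
  qed
  have meas [measurable]: "(\<lambda>f. \<Sum>b\<in>B. f b *\<^sub>R g b) \<in> ?M \<rightarrow>\<^sub>M borel"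
    by measurable
  have std: "lborel = distr ?M borel (\<lambda>f. \<Sum>b\<in>B. f b *\<^sub>R g b)"
  proof (rule lborel_eqI)
    fix l u :: "real ^ 'n"
    assume lu: "\<And>i. i \<in> Basis \<Longrightarrow> l \<bullet> i \<le> u \<bullet> i"
    have "(\<lambda>f. \<Sum>b\<in>B. f b *\<^sub>R g b) -` box l u \<inter> space ?M = (\<Pi>\<^sub>E b\<in>B. {l \<bullet> g b <..< u \<bullet> g b})"
    proof (intro equalityI subsetI)
      fix f assume f: "f \<in> (\<lambda>f. \<Sum>b\<in>B. f b *\<^sub>R g b) -` box l u \<inter> space ?M"
      then have "l \<bullet> i < f (h i) \<and> f (h i) < u \<bullet> i" if "i \<in> Basis" for i
        using that by (auto simp: mem_box coord)
      from this[OF gB] f show "f \<in> (\<Pi>\<^sub>E b\<in>B. {l \<bullet> g b <..< u \<bullet> g b})"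
        by (auto simp: space_PiM PiE_iff hg)
    next
      fix f assume f: "f \<in> (\<Pi>\<^sub>E b\<in>B. {l \<bullet> g b <..< u \<bullet> g b})"
      have "l \<bullet> i < f (h i) \<and> f (h i) < u \<bullet> i" if "i \<in> Basis" for i
        using PiE_mem[OF f hB[OF that]] gh[OF that] by simp
      with f show "f \<in> (\<lambda>f. \<Sum>b\<in>B. f b *\<^sub>R g b) -` box l u \<inter> space ?M"
        by (auto simp: mem_box coord space_PiM PiE_iff)
    qed
    then have "emeasure (distr ?M borel (\<lambda>f. \<Sum>b\<in>B. f b *\<^sub>R g b)) (box l u)
        = emeasure ?M (\<Pi>\<^sub>E b\<in>B. {l \<bullet> g b <..< u \<bullet> g b})"
      by (subst emeasure_distr) auto
    also have "\<dots> = (\<Prod>b\<in>B. emeasure lborel {l \<bullet> g b <..< u \<bullet> g b})"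
      using fin by (intro emeasure_PiM) auto
    also have "\<dots> = (\<Prod>b\<in>B. ennreal ((u - l) \<bullet> g b))"
      by (intro prod.cong) (auto simp: lu gB inner_diff_left)
    also have "\<dots> = (\<Prod>i\<in>Basis. ennreal ((u - l) \<bullet> i))"
      by (rule prod.reindex_bij_betw[OF g])
    also have "\<dots> = ennreal (\<Prod>i\<in>Basis. (u - l) \<bullet> i)"
      using lu by (intro prod_ennreal) (auto simp: inner_diff_left)
    finally show "emeasure (distr ?M borel (\<lambda>f. \<Sum>b\<in>B. f b *\<^sub>R g b)) (box l u) = (\<Prod>i\<in>Basis. (u - l) \<bullet> i)" .
  qed simp
  define T where "T = (\<lambda>x :: real ^ 'n. \<Sum>i\<in>Basis. (x \<bullet> i) *\<^sub>R h i)"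
  have "linear T"
    unfolding T_def by (rule linearI) (auto simp: inner_left_distrib scaleR_add_left sum.distrib scaleR_right.sum)
  have "T x \<bullet> T y = x \<bullet> y" for x y
  proof -
    have "T x \<bullet> T y = (\<Sum>j\<in>Basis. \<Sum>i\<in>Basis. (x \<bullet> i) * ((y \<bullet> j) * (h i \<bullet> h j)))"
      by (simp add: T_def inner_sum_left inner_sum_right sum_distrib_left mult_ac)
    also have "\<dots> = (\<Sum>j\<in>Basis. \<Sum>i\<in>Basis. if i = j then (x \<bullet> i) * (y \<bullet> j) else 0)"
    proof (intro sum.cong refl)
      fix i j :: "real ^ 'n" assume ij: "i \<in> Basis" "j \<in> Basis"
      have "h i = h j \<longleftrightarrow> i = j" using ij gh by metis
      then show "(x \<bullet> i) * ((y \<bullet> j) * (h i \<bullet> h j)) = (if i = j then (x \<bullet> i) * (y \<bullet> j) else 0)"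
        using orthonormal_basis_of_inner[OF B hB[OF ij(1)] hB[OF ij(2)]] by simp
    qed
    also have "\<dots> = x \<bullet> y" by (simp add: euclidean_inner[of x y])
    finally show ?thesis .
  qed
  with \<open>linear T\<close> have T: "orthogonal_transformation T"
    by (simp add: orthogonal_transformation_def)
  have Tg: "T (\<Sum>b\<in>B. f b *\<^sub>R g b) = (\<Sum>b\<in>B. f b *\<^sub>R b)" for f
  proof -
    have "T (\<Sum>b\<in>B. f b *\<^sub>R g b) = (\<Sum>i\<in>Basis. f (h i) *\<^sub>R h i)"
      unfolding T_def by (intro sum.cong) (auto simp: coord)
    also have "\<dots> = (\<Sum>b\<in>B. f b *\<^sub>R b)" by (rule sum.reindex_bij_betw[OF h])
    finally show ?thesis .
  qed
  have [measurable]: "T \<in> borel_measurable borel" by (rule borel_measurable_linear) fact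
  have "distr ?M borel (\<lambda>f. \<Sum>b\<in>B. f b *\<^sub>R b) = distr ?M borel (T \<circ> (\<lambda>f. \<Sum>b\<in>B. f b *\<^sub>R g b))"
    by (simp add: o_def Tg)
  also have "\<dots> = distr (distr ?M borel (\<lambda>f. \<Sum>b\<in>B. f b *\<^sub>R g b)) borel T"
    by (rule distr_distr[symmetric]) measurable
  also have "\<dots> = lborel" unfolding std[symmetric] by (rule distr_orthogonal[OF T])
  finally show ?thesis .
qed

lemma orthonormal_basis_of_exists: "subspace E \<Longrightarrow> \<exists>B. orthonormal_basis_of E B"
  unfolding orthonormal_basis_of_def by (metis orthonormal_basis_subspace)

lemma subspace_lborel_basis:
  assumes "subspace E"
  obtains B where "orthonormal_basis_of E B"
    "subspace_lborel E = distr (\<Pi>\<^sub>M b\<in>B. (lborel :: real measure)) borel (\<lambda>f. \<Sum>b\<in>B. f b *\<^sub>R b)"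
  using that someI_ex[OF orthonormal_basis_of_exists[OF assms]] by (auto simp: subspace_lborel_def Let_def)

lemma subspace_lborel_UNIV: "subspace_lborel (UNIV :: (real ^ 'n::finite) set) = lborel"
proof -
  obtain B :: "(real ^ 'n) set" where "orthonormal_basis_of UNIV B"
    "subspace_lborel UNIV = distr (\<Pi>\<^sub>M b\<in>B. (lborel :: real measure)) borel (\<lambda>f. \<Sum>b\<in>B. f b *\<^sub>R b)"
    by (rule subspace_lborel_basis[OF subspace_UNIV])
  then show ?thesis by (simp only: lborel_orthonormal_coordinates)
qed

lemma subspace_perp: "subspace (perp \<xi>)"
  unfolding perp_def subspace_def by (auto simp: inner_left_distrib)

text \<open>
  An orthonormal basis of the hyperplane together with \<open>\<xi>\<close> is one of the whole space; integrating
  the coordinate along \<open>\<xi>\<close> first gives the factor \<open>1\<close>. This turns all volumes in hyperplanes into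
  volumes in the whole space.
\<close>
lemma measure_subspace_lborel_perp:
  fixes \<xi> :: "real ^ 'n::finite"
  assumes \<xi>: "norm \<xi> = 1" and A: "compact A" "A \<subseteq> perp \<xi>"
  shows "measure (subspace_lborel (perp \<xi>)) A = vol (A + closed_segment 0 \<xi>)"
proof -
  obtain B where B: "orthonormal_basis_of (perp \<xi>) B" and
    sl: "subspace_lborel (perp \<xi>) = distr (\<Pi>\<^sub>M b\<in>B. (lborel :: real measure)) borel (\<lambda>f. \<Sum>b\<in>B. f b *\<^sub>R b)"
    using subspace_lborel_basis[OF subspace_perp] .
  have \<xi>\<xi>: "\<xi> \<bullet> \<xi> = 1" using \<xi> by (simp add: norm_eq_1)
  have Bp: "b \<bullet> \<xi> = 0" if "b \<in> B" for b using that B by (auto simp: orthonormal_basis_of_def perp_def)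
  have notin: "\<xi> \<notin> B" using Bp[of \<xi>] \<xi>\<xi> by auto
  have "orthonormal_basis_of UNIV (insert \<xi> B)"
    unfolding orthonormal_basis_of_def
  proof (intro conjI)
    show "pairwise orthogonal (insert \<xi> B)"
      using B Bp by (auto simp: orthonormal_basis_of_def pairwise_insert orthogonal_def inner_commute)
    show "\<forall>b\<in>insert \<xi> B. norm b = 1" using B \<xi> by (auto simp: orthonormal_basis_of_def)
    have "x \<in> span (insert \<xi> B)" for x
    proof -
      have "x - (x \<bullet> \<xi>) *\<^sub>R \<xi> \<in> perp \<xi>" by (simp add: perp_def inner_diff_left \<xi>\<xi>)
      then have "x - (x \<bullet> \<xi>) *\<^sub>R \<xi> \<in> span B" using B by (simp add: orthonormal_basis_of_def)
      then show ?thesis unfolding span_breakdown_eq by blast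
    qed
    then show "span (insert \<xi> B) = UNIV" by blast
  qed simp
  note std = lborel_orthonormal_coordinates[OF this]
  note fin = orthonormal_basis_of_finite[OF B]
  interpret product_sigma_finite "\<lambda>_ :: real ^ 'n. (lborel :: real measure)" ..
  define F where "F = (\<lambda>f. \<Sum>b\<in>B. f b *\<^sub>R b)"
  have [measurable]: "F \<in> (\<Pi>\<^sub>M b\<in>B. (lborel :: real measure)) \<rightarrow>\<^sub>M borel" unfolding F_def by measurable
  have meas: "(\<lambda>f. \<Sum>b\<in>insert \<xi> B. f b *\<^sub>R b) \<in> (\<Pi>\<^sub>M b\<in>insert \<xi> B. (lborel :: real measure)) \<rightarrow>\<^sub>M borel"
    by measurable
  have [measurable]: "A \<in> sets borel" "A + closed_segment 0 \<xi> \<in> sets borel"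
    using A by (simp_all add: borel_compact compact_set_plus)
  have F: "F f \<bullet> \<xi> = 0" for f by (simp add: F_def inner_sum_left Bp)
  have upd: "(\<Sum>b\<in>insert \<xi> B. (f(\<xi> := y)) b *\<^sub>R b) = F f + y *\<^sub>R \<xi>" for f y
  proof -
    have "(\<Sum>b\<in>B. (f(\<xi> := y)) b *\<^sub>R b) = F f"
      unfolding F_def by (intro sum.cong) (use notin in auto)
    then show ?thesis using fin notin by (simp add: add.commute)
  qed
  have ind: "indicator (A + closed_segment 0 \<xi>) (F f + y *\<^sub>R \<xi>) = (indicator A (F f) * indicator {0..1} y :: ennreal)" for f y
  proof -
    have "F f + y *\<^sub>R \<xi> \<in> A + closed_segment 0 \<xi> \<longleftrightarrow> F f \<in> A \<and> 0 \<le> y \<and> y \<le> 1"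
    proof
      assume "F f + y *\<^sub>R \<xi> \<in> A + closed_segment 0 \<xi>"
      then obtain a s where as: "F f + y *\<^sub>R \<xi> = a + s *\<^sub>R \<xi>" "a \<in> A" "0 \<le> s" "s \<le> 1"
        by (auto simp: set_plus_def in_segment)
      have "a \<bullet> \<xi> = 0" using as(2) A(2) by (auto simp: perp_def)
      with arg_cong[OF as(1), of "\<lambda>x. x \<bullet> \<xi>"] F \<xi>\<xi> have "y = s" by (simp add: inner_left_distrib)
      then show "F f \<in> A \<and> 0 \<le> y \<and> y \<le> 1" using as by auto
    next
      assume "F f \<in> A \<and> 0 \<le> y \<and> y \<le> 1"
      moreover from this have "y *\<^sub>R \<xi> \<in> closed_segment 0 \<xi>" by (auto simp: in_segment)
      ultimately show "F f + y *\<^sub>R \<xi> \<in> A + closed_segment 0 \<xi>" by (simp add: set_plus_intro)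
    qed
    then show ?thesis by (auto simp: indicator_def)
  qed
  have "emeasure lborel (A + closed_segment 0 \<xi>) = (\<integral>\<^sup>+ x. indicator (A + closed_segment 0 \<xi>) x \<partial>lborel)"
    by (simp add: nn_integral_indicator)
  also have "\<dots> = (\<integral>\<^sup>+ f. indicator (A + closed_segment 0 \<xi>) (\<Sum>b\<in>insert \<xi> B. f b *\<^sub>R b) \<partial>(\<Pi>\<^sub>M b\<in>insert \<xi> B. (lborel :: real measure)))"
    unfolding std[symmetric] by (rule nn_integral_distr[OF meas]) simp
  also have "\<dots> = (\<integral>\<^sup>+ f. (\<integral>\<^sup>+ y. indicator (A + closed_segment 0 \<xi>) (\<Sum>b\<in>insert \<xi> B. (f(\<xi> := y)) b *\<^sub>R b) \<partial>lborel) \<partial>(\<Pi>\<^sub>M b\<in>B. (lborel :: real measure)))"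
    by (rule product_nn_integral_insert[OF fin notin]) (use meas in measurable)
  also have "\<dots> = (\<integral>\<^sup>+ f. indicator A (F f) \<partial>(\<Pi>\<^sub>M b\<in>B. (lborel :: real measure)))"
    unfolding upd ind by (simp add: nn_integral_cmult)
  also have "\<dots> = (\<integral>\<^sup>+ x. indicator A x \<partial>subspace_lborel (perp \<xi>))"
    unfolding sl F_def[symmetric] by (rule nn_integral_distr[symmetric]) auto
  also have "\<dots> = emeasure (subspace_lborel (perp \<xi>)) A"
    by (rule nn_integral_indicator) (simp add: sl)
  finally have "measure lborel (A + closed_segment 0 \<xi>) = measure (subspace_lborel (perp \<xi>)) A"
    by (simp add: measure_def)
  then show ?thesis using \<open>A + closed_segment 0 \<xi> \<in> sets borel\<close> by (simp add: measure_completion)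
qed

section \<open>Surface area as a growth rate\<close>

text \<open>
  Up to the factor \<open>n\<close> this is the mixed volume of \<open>n - 1\<close> copies of \<open>C\<close> and one copy of the image of
  the unit ball under \<open>P\<close>. It is the surface area of \<open>C\<close> when \<open>P\<close> is the identity, and of a section
  when \<open>C\<close> is a cylinder over it and \<open>P\<close> projects along the axis.
\<close>
definition growth_rate :: "(real ^ 'n::finite \<Rightarrow> real ^ 'n) \<Rightarrow> (real ^ 'n) set \<Rightarrow> real" where
  "growth_rate P C = Lim (at_right 0) (\<lambda>t. (vol (C + P ` cball 0 t) - vol C) / t)"

context
  fixes C :: "(real ^ 'n::finite) set" and P :: "real ^ 'n \<Rightarrow> real ^ 'n"
  assumes C: "compact C" "convex C" and P: "linear P"
begin

text \<open>
  Superadditivity of the increment is \<open>vol_add_ball_mono\<close> for the pair \<open>C\<close> and \<open>C + P(sB)\<close>.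
\<close>
lemma growth_rate_limit:
  shows tendsto_growth_rate: "((\<lambda>t. (vol (C + P ` cball 0 t) - vol C) / t) \<longlongrightarrow> growth_rate P C) (at_right 0)"
    and growth_rate_le: "\<And>t. t > 0 \<Longrightarrow> growth_rate P C \<le> (vol (C + P ` cball 0 t) - vol C) / t"
proof -
  have sub: "C \<subseteq> C + P ` cball 0 t" if "t > 0" for t
  proof -
    have "0 \<in> P ` cball 0 t" using linear_0[OF P] that by (auto simp: image_iff intro!: bexI[of _ 0])
    then show ?thesis by (metis set_zero_plus2 add.commute)
  qed
  have comp: "compact (C + P ` cball 0 t)" "convex (C + P ` cball 0 t)" for t
    using C P by (simp_all add: compact_set_plus convex_set_plus compact_linear_image convex_linear_image)
  obtain L where L: "((\<lambda>t. (vol (C + P ` cball 0 t) - vol C) / t) \<longlongrightarrow> L) (at_right 0)"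
    "\<And>t. t > 0 \<Longrightarrow> L \<le> (vol (C + P ` cball 0 t) - vol C) / t"
  proof (rule superadditive_quotient_tendsto)
    fix t :: real assume "t > 0"
    then show "vol (C + P ` cball 0 t) - vol C \<ge> 0"
      using vol_mono[OF C(1) comp(1) sub] by simp
  next
    fix s t :: real assume st: "s > 0" "t > 0"
    have "vol (C + P ` cball 0 t) - vol C \<le> vol ((C + P ` cball 0 s) + P ` cball 0 t) - vol (C + P ` cball 0 s)"
      using st by (intro vol_add_ball_mono C comp sub P) auto
    moreover have "P ` cball 0 (s + t) = P ` cball 0 s + P ` cball 0 t"
      using st by (simp add: cball_plus_cball[symmetric] linear_image_set_plus[OF P])
    ultimately show "(vol (C + P ` cball 0 s) - vol C) + (vol (C + P ` cball 0 t) - vol C)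
        \<le> vol (C + P ` cball 0 (s + t)) - vol C"
      by (simp add: add.assoc)
  qed blast
  moreover from L(1) have "growth_rate P C = L"
    unfolding growth_rate_def by (intro tendsto_Lim) auto
  ultimately show "((\<lambda>t. (vol (C + P ` cball 0 t) - vol C) / t) \<longlongrightarrow> growth_rate P C) (at_right 0)"
    "\<And>t. t > 0 \<Longrightarrow> growth_rate P C \<le> (vol (C + P ` cball 0 t) - vol C) / t"
    by simp_all
qed

end

lemma growth_rate_ge:
  fixes C :: "(real ^ 'n::finite) set"
  assumes C: "compact C" "convex C" "linear P"
    and le: "\<And>t. t > 0 \<Longrightarrow> a * t \<le> vol (C + P ` cball 0 t) - vol C"
  shows "a \<le> growth_rate P C"
proof (rule tendsto_lowerbound[OF tendsto_growth_rate[OF C]])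
  show "\<forall>\<^sub>F t in at_right 0. a \<le> (vol (C + P ` cball 0 t) - vol C) / t"
    using eventually_at_right_less[of "0::real"]
    by eventually_elim (use le in \<open>simp add: field_simps\<close>)
qed simp

lemma growth_rate_mono:
  fixes C C' :: "(real ^ 'n::finite) set"
  assumes "compact C" "convex C" "compact C'" "convex C'" "C \<subseteq> C'" "linear P"
  shows "growth_rate P C \<le> growth_rate P C'"
proof (rule growth_rate_ge)
  fix t :: real assume "t > 0"
  then have "growth_rate P C * t \<le> vol (C + P ` cball 0 t) - vol C"
    using growth_rate_le[OF assms(1,2,6), of t] by (simp add: field_simps)
  also have "\<dots> \<le> vol (C' + P ` cball 0 t) - vol C'"
    using \<open>t > 0\<close> by (intro vol_add_ball_mono assms) auto
  finally show "growth_rate P C * t \<le> vol (C' + P ` cball 0 t) - vol C'" .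
qed fact+

lemma Lim_cong_right:
  assumes "\<And>t. t > 0 \<Longrightarrow> f t = g (t::real)"
  shows "Lim (at_right 0) f = Lim (at_right 0) g"
proof -
  have "\<forall>\<^sub>F t in at_right 0. f t = g t"
    using eventually_at_right_less[of "0::real"] by eventually_elim (use assms in auto)
  then have "(f \<longlongrightarrow> L) (at_right 0) \<longleftrightarrow> (g \<longlongrightarrow> L) (at_right 0)" for L
    by (rule tendsto_cong)
  then show ?thesis by (simp add: t2_space_class.Lim_def)
qed

lemma parallel_set_conv:
  fixes A D :: "'a::real_vector set"
  shows "{a + t *\<^sub>R b |a b. a \<in> A \<and> b \<in> D} = A + (*\<^sub>R) t ` D"
  unfolding set_plus_def by blast

lemma surface_area_UNIV:
  fixes K :: "(real ^ 'n::finite) set"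
  assumes K: "compact K" "K \<noteq> {}"
  shows "surface_area UNIV K = growth_rate (\<lambda>x. x) K"
proof -
  have "{a + t *\<^sub>R b |a b. a \<in> K \<and> b \<in> cball 0 1 \<inter> UNIV} = K + cball 0 t" if "t > 0" for t
  proof -
    have "{a + t *\<^sub>R b |a b. a \<in> K \<and> b \<in> cball 0 1 \<inter> UNIV} = K + (*\<^sub>R) t ` cball 0 1"
      unfolding parallel_set_conv by simp
    then show ?thesis using cball_scale[of t "0 :: real ^ 'n" 1] that by simp
  qed
  then show ?thesis
    using K unfolding surface_area_def growth_rate_def
    by (auto intro!: Lim_cong_right simp: subspace_lborel_UNIV measure_completion borel_compact compact_set_plus)
qed

definition project_out :: "'a::real_inner \<Rightarrow> 'a \<Rightarrow> 'a" where
  "project_out \<xi> x = x - (x \<bullet> \<xi>) *\<^sub>R \<xi>"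

lemma linear_project_out: "linear (project_out \<xi>)"
  by (rule linearI) (auto simp: project_out_def algebra_simps inner_left_distrib)

lemma project_out_id: "x \<in> perp \<xi> \<Longrightarrow> project_out \<xi> x = x"
  by (simp add: project_out_def perp_def)

lemma project_out_in_perp: "norm \<xi> = 1 \<Longrightarrow> project_out \<xi> x \<in> perp \<xi>"
  by (simp add: project_out_def perp_def inner_diff_left norm_eq_1)

lemma norm_project_out_le:
  assumes "norm \<xi> = 1"
  shows "norm (project_out \<xi> x) \<le> norm x"
proof -
  have "\<xi> \<bullet> \<xi> = 1" using assms by (simp add: norm_eq_1)
  then have "project_out \<xi> x \<bullet> project_out \<xi> x = x \<bullet> x - (x \<bullet> \<xi>) * (x \<bullet> \<xi>)"
    by (simp add: project_out_def inner_diff_left inner_diff_right inner_commute)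
  also have "\<dots> \<le> x \<bullet> x" by simp
  finally show ?thesis by (simp add: norm_le)
qed

text \<open>
  Passing to parallel bodies inside the hyperplane commutes with forming the cylinder in direction
  \<open>\<xi>\<close>, so the two difference quotients agree term by term. The empty section is consistent with this:
  all quotients vanish.
\<close>
lemma surface_area_perp:
  fixes A :: "(real ^ 'n::finite) set"
  assumes \<xi>: "norm \<xi> = 1" and A: "compact A" "A \<subseteq> perp \<xi>"
  shows "surface_area (perp \<xi>) A = growth_rate (project_out \<xi>) (A + closed_segment 0 \<xi>)"
proof (cases "A = {}")
  case True
  have "((\<lambda>t::real. 0 :: real) \<longlongrightarrow> 0) (at_right 0)" by simp
  then have "Lim (at_right (0::real)) (\<lambda>t. 0 :: real) = 0" by (intro tendsto_Lim) auto
  then show ?thesis using True by (simp add: surface_area_def growth_rate_def)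
next
  case False
  let ?P = "project_out \<xi>" and ?S = "closed_segment 0 \<xi>"
  have eq: "{a + t *\<^sub>R b |a b. a \<in> A \<and> b \<in> cball 0 1 \<inter> perp \<xi>} = A + ?P ` cball 0 t" if "t > 0" for t
  proof -
    have "(*\<^sub>R) t ` (cball 0 1 \<inter> perp \<xi>) = ?P ` cball 0 t"
    proof (intro equalityI subsetI)
      fix x assume "x \<in> (*\<^sub>R) t ` (cball 0 1 \<inter> perp \<xi>)"
      then obtain b where b: "x = t *\<^sub>R b" "norm b \<le> 1" "b \<in> perp \<xi>" by fastforce
      then have "x \<in> perp \<xi>" by (simp add: perp_def)
      moreover have "norm x \<le> t" using b that by (simp add: mult_le_cancel_left1)
      ultimately show "x \<in> ?P ` cball 0 t" by (metis project_out_id image_eqI mem_cball_0)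
    next
      fix x assume "x \<in> ?P ` cball 0 t"
      then obtain y where y: "x = ?P y" "norm y \<le> t" by auto
      then have "norm x \<le> t" "x \<in> perp \<xi>"
        using norm_project_out_le[OF \<xi>, of y] project_out_in_perp[OF \<xi>] by auto
      then have "(1 / t) *\<^sub>R x \<in> cball 0 1 \<inter> perp \<xi>" using that by (simp add: perp_def)
      moreover have "x = t *\<^sub>R ((1 / t) *\<^sub>R x)" using that by simp
      ultimately show "x \<in> (*\<^sub>R) t ` (cball 0 1 \<inter> perp \<xi>)" by blast
    qed
    moreover have "{a + t *\<^sub>R b |a b. a \<in> A \<and> b \<in> cball 0 1 \<inter> perp \<xi>} = A + (*\<^sub>R) t ` (cball 0 1 \<inter> perp \<xi>)"
      by (rule parallel_set_conv)
    ultimately show ?thesis by simp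
  qed
  have m: "measure (subspace_lborel (perp \<xi>)) (A + ?P ` cball 0 t) = vol ((A + ?S) + ?P ` cball 0 t)" for t
  proof -
    have "A + ?P ` cball 0 t \<subseteq> perp \<xi>"
      using A(2) project_out_in_perp[OF \<xi>] subspace_perp[of \<xi>] by (auto simp: set_plus_def subspace_add)
    moreover have "compact (A + ?P ` cball 0 t)"
      using A(1) by (simp add: compact_set_plus compact_linear_image linear_project_out)
    ultimately show ?thesis
      using measure_subspace_lborel_perp[OF \<xi>] by (simp add: add.assoc add.commute[of ?S])
  qed
  have "surface_area (perp \<xi>) A = Lim (at_right 0) (\<lambda>t.
      (measure (subspace_lborel (perp \<xi>)) {a + t *\<^sub>R b |a b. a \<in> A \<and> b \<in> cball 0 1 \<inter> perp \<xi>}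
        - measure (subspace_lborel (perp \<xi>)) A) / t)"
    using False by (simp only: surface_area_def if_False)
  also have "\<dots> = growth_rate ?P (A + ?S)"
    unfolding growth_rate_def
    by (rule Lim_cong_right) (simp only: eq m measure_subspace_lborel_perp[OF \<xi> A])
  finally show ?thesis .
qed

lemma surface_area_orthogonal:
  fixes A :: "(real ^ 'n::finite) set" and Q :: "real ^ 'n \<Rightarrow> real ^ 'n"
  assumes Q: "orthogonal_transformation Q" and \<xi>: "norm \<xi> = 1" and A: "compact A" "A \<subseteq> perp \<xi>"
  shows "surface_area (perp (Q \<xi>)) (Q ` A) = surface_area (perp \<xi>) A"
proof -
  have lin: "linear Q" using Q by (rule orthogonal_transformation_linear)
  have inner: "Q x \<bullet> Q y = x \<bullet> y" for x y using Q by (simp add: orthogonal_transformation_def)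
  have seg: "closed_segment 0 (Q \<xi>) = Q ` closed_segment 0 \<xi>"
    using closed_segment_linear_image[OF lin, of 0 \<xi>] by (simp add: linear_0[OF lin])
  have ball: "project_out (Q \<xi>) ` cball 0 t = Q ` project_out \<xi> ` cball 0 t" for t
  proof -
    have eq: "project_out (Q \<xi>) (Q x) = Q (project_out \<xi> x)" for x
      by (simp add: project_out_def inner linear_diff[OF lin] linear_cmul[OF lin])
    have "cball 0 t = Q ` cball 0 t"
      using image_orthogonal_transformation_cball[OF Q, of 0 t] by (simp add: linear_0[OF lin])
    then have "project_out (Q \<xi>) ` cball 0 t = (\<lambda>x. project_out (Q \<xi>) (Q x)) ` cball 0 t"
      by (simp only: image_image[symmetric])
    also have "\<dots> = Q ` project_out \<xi> ` cball 0 t"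
      by (simp only: eq image_image)
    finally show ?thesis .
  qed
  have c: "compact (A + closed_segment 0 \<xi>)" "compact (A + closed_segment 0 \<xi> + project_out \<xi> ` cball 0 t)" for t
    using A by (simp_all add: compact_set_plus compact_linear_image linear_project_out)
  have "Q ` A \<subseteq> perp (Q \<xi>)" using A by (auto simp: perp_def inner)
  then have "surface_area (perp (Q \<xi>)) (Q ` A) = growth_rate (project_out (Q \<xi>)) (Q ` (A + closed_segment 0 \<xi>))"
    using surface_area_perp[of "Q \<xi>" "Q ` A"] \<xi> A orthogonal_transformation_norm[OF Q, of \<xi>] lin
    by (simp add: compact_linear_image linear_image_set_plus seg)
  also have "\<dots> = growth_rate (project_out \<xi>) (A + closed_segment 0 \<xi>)"
    unfolding growth_rate_def ball linear_image_set_plus[OF lin, symmetric]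
    using c by (simp add: measure_orthogonal_image_finite[OF Q])
  also have "\<dots> = surface_area (perp \<xi>) A" by (rule surface_area_perp[OF \<xi> A, symmetric])
  finally show ?thesis .
qed

section \<open>A section of largest surface area\<close>

text \<open>
  If there were no maximum, every \<open>x\<close> would have a point \<open>b x\<close> with a larger value, and
  \<open>F < F (b x)\<close> would hold near \<open>x\<close>. Finitely many such neighbourhoods cover \<open>S\<close>, and the largest of
  the finitely many values \<open>F (b x)\<close> would be smaller than one of them.
\<close>
lemma usc_attains_max:
  fixes F :: "'a::metric_space \<Rightarrow> real"
  assumes "compact S" "S \<noteq> {}"
    and usc: "\<And>x y. x \<in> S \<Longrightarrow> F x < y \<Longrightarrow> \<exists>d>0. \<forall>x'\<in>S. dist x' x < d \<longrightarrow> F x' < y"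
  shows "\<exists>x\<in>S. \<forall>x'\<in>S. F x' \<le> F x"
proof (rule ccontr)
  assume "\<not> ?thesis"
  then obtain b where b: "\<And>x. x \<in> S \<Longrightarrow> b x \<in> S \<and> F x < F (b x)" by (metis not_le)
  with usc have "\<forall>x\<in>S. \<exists>d. d > 0 \<and> (\<forall>x'\<in>S. dist x' x < d \<longrightarrow> F x' < F (b x))" by blast
  from bchoice[OF this] obtain d where
    "\<forall>x\<in>S. d x > 0 \<and> (\<forall>x'\<in>S. dist x' x < d x \<longrightarrow> F x' < F (b x))" ..
  then have d: "\<And>x. x \<in> S \<Longrightarrow> d x > 0"
    "\<And>x x'. x \<in> S \<Longrightarrow> x' \<in> S \<Longrightarrow> dist x' x < d x \<Longrightarrow> F x' < F (b x)" by blast+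
  have "S \<subseteq> (\<Union>x\<in>S. ball x (d x))" using d(1) by (auto intro!: bexI)
  then obtain T where T: "T \<subseteq> S" "finite T" "S \<subseteq> (\<Union>x\<in>T. ball x (d x))"
    using compactE_image[OF \<open>compact S\<close>, of S "\<lambda>x. ball x (d x)"] by auto
  then have "T \<noteq> {}" using \<open>S \<noteq> {}\<close> by auto
  then have "Max ((\<lambda>x. F (b x)) ` T) \<in> (\<lambda>x. F (b x)) ` T"
    using T(2) by (intro Max_in) auto
  then obtain z where z': "z \<in> T" "Max ((\<lambda>x. F (b x)) ` T) = F (b z)" by blast
  have z: "F (b x) \<le> F (b z)" if "x \<in> T" for x
    unfolding z'(2)[symmetric] using T(2) that by (intro Max_ge) auto
  have "b z \<in> S" using b z' T by auto
  then obtain x where x: "x \<in> T" "dist x (b z) < d x" using T(3) by auto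
  then have "F (b z) < F (b x)" using d(2)[of x "b z"] T(1) \<open>b z \<in> S\<close> by (auto simp: dist_commute)
  then show False using z[OF x(1)] by simp
qed

text \<open>
  Sections by different hyperplanes are compared inside a common one by the reflection along
  \<open>\<xi> + \<xi>'\<close>: it maps the hyperplane orthogonal to \<open>\<xi>'\<close> to the one orthogonal to \<open>\<xi>\<close>, and it moves the
  points of a bounded part of the former only a little when \<open>\<xi>'\<close> is near \<open>\<xi>\<close>. The reflection along
  \<open>\<xi> - \<xi>'\<close> also maps one hyperplane to the other, but does not have the second property.
\<close>
definition reflect :: "'a::real_inner \<Rightarrow> 'a \<Rightarrow> 'a" where
  "reflect m x = x - (2 * (x \<bullet> m) / (m \<bullet> m)) *\<^sub>R m"

lemma orthogonal_reflect: "orthogonal_transformation (reflect m)"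
proof (cases "m = 0")
  case False
  then have mm: "m \<bullet> m \<noteq> 0" by simp
  have "linear (reflect m)"
    by (rule linearI) (auto simp: reflect_def inner_left_distrib algebra_simps add_divide_distrib)
  moreover have "reflect m x \<bullet> reflect m y = x \<bullet> y" for x y
    using mm by (simp add: reflect_def inner_diff_left inner_diff_right field_simps inner_commute)
  ultimately show ?thesis by (simp add: orthogonal_transformation_def)
qed (simp add: reflect_def[abs_def])

lemma reflect_sum_unit:
  assumes "norm \<xi> = 1" "norm \<xi>' = 1" "\<xi> + \<xi>' \<noteq> 0"
  shows "reflect (\<xi> + \<xi>') \<xi>' = - \<xi>"
proof -
  have "2 * (\<xi>' \<bullet> (\<xi> + \<xi>')) = (\<xi> + \<xi>') \<bullet> (\<xi> + \<xi>')"
    using assms by (simp add: norm_eq_1 inner_left_distrib inner_right_distrib inner_commute)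
  moreover have "(\<xi> + \<xi>') \<bullet> (\<xi> + \<xi>') \<noteq> 0" using assms by simp
  ultimately have "2 * (\<xi>' \<bullet> (\<xi> + \<xi>')) / ((\<xi> + \<xi>') \<bullet> (\<xi> + \<xi>')) = 1" by simp
  then have "reflect (\<xi> + \<xi>') \<xi>' = \<xi>' - 1 *\<^sub>R (\<xi> + \<xi>')" by (simp only: reflect_def)
  then show ?thesis by simp
qed

lemma convex_perp: "convex (perp \<xi>)"
  by (rule subspace_imp_convex[OF subspace_perp])

lemma closed_perp: "closed (perp (\<xi> :: 'a::euclidean_space))"
  by (rule closed_subspace[OF subspace_perp])

text \<open>
  Points of \<open>K\<close> far from the section by \<open>\<xi>\<close> keep a positive distance from the hyperplane by
  compactness, so they are missed by all nearby hyperplanes. Sections can therefore only shrink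
  suddenly, never grow. The statement includes the case of an empty section.
\<close>
lemma section_near:
  fixes K :: "(real ^ 'n::finite) set"
  assumes K: "compact K" and \<xi>: "norm \<xi> = 1" and "\<delta> > 0"
  obtains d where "d > 0" "\<And>\<xi>'. norm \<xi>' = 1 \<Longrightarrow> dist \<xi>' \<xi> < d \<Longrightarrow>
    \<xi> + \<xi>' \<noteq> 0 \<and> reflect (\<xi> + \<xi>') ` (K \<inter> perp \<xi>') \<subseteq> (K \<inter> perp \<xi>) + project_out \<xi> ` cball 0 \<delta>"
proof -
  obtain R where R: "R > 0" "\<And>x. x \<in> K \<Longrightarrow> norm x \<le> R"
    using compact_imp_bounded[OF K] by (auto simp: bounded_pos)
  define U where "U = (\<Union>a\<in>K \<inter> perp \<xi>. ball a (\<delta> / 2))"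
  have "compact (K - U)" unfolding U_def by (intro compact_diff K) auto
  have "\<exists>\<eta>>0. \<forall>x\<in>K - U. \<eta> \<le> \<bar>x \<bullet> \<xi>\<bar>"
  proof (cases "K - U = {}")
    case False
    have "continuous_on (K - U) (\<lambda>x. \<bar>x \<bullet> \<xi>\<bar>)" by (intro continuous_intros)
    then obtain z where z: "z \<in> K - U" "\<And>x. x \<in> K - U \<Longrightarrow> \<bar>z \<bullet> \<xi>\<bar> \<le> \<bar>x \<bullet> \<xi>\<bar>"
      using continuous_attains_inf[OF \<open>compact (K - U)\<close> False] by blast
    have "z \<bullet> \<xi> \<noteq> 0"
    proof
      assume "z \<bullet> \<xi> = 0"
      then have "z \<in> K \<inter> perp \<xi>" using z by (simp add: perp_def)
      then have "z \<in> U" unfolding U_def using \<open>\<delta> > 0\<close> by (intro UN_I[of z]) auto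
      then show False using z by simp
    qed
    then show ?thesis using z(2) by (intro exI[of _ "\<bar>z \<bullet> \<xi>\<bar>"]) auto
  qed (auto intro: exI[of _ 1])
  then obtain \<eta> where \<eta>: "\<eta> > 0" "\<And>x. x \<in> K \<Longrightarrow> x \<notin> U \<Longrightarrow> \<eta> \<le> \<bar>x \<bullet> \<xi>\<bar>" by auto
  \<comment> \<open>The bound \<open>1\<close> keeps \<open>\<xi> + \<xi>'\<close> at norm at least \<open>1\<close>, the second bound forces points of the
    nearby section into \<open>U\<close>, and the third limits the displacement by the reflection to \<open>\<delta> / 2\<close>.\<close>
  define d where "d = min 1 (min (\<eta> / R) (\<delta> / (4 * R)))"
  have "d > 0" using \<eta> R \<open>\<delta> > 0\<close> by (simp add: d_def)
  show thesis
  proof (rule that[OF \<open>d > 0\<close>])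
    fix \<xi>' :: "real ^ 'n" assume \<xi>': "norm \<xi>' = 1" "dist \<xi>' \<xi> < d"
    define m where "m = \<xi> + \<xi>'"
    have dist: "norm (\<xi> - \<xi>') < 1" "R * norm (\<xi> - \<xi>') < \<eta>" "4 * (R * norm (\<xi> - \<xi>')) < \<delta>"
      using \<xi>'(2) R by (simp_all add: d_def dist_norm norm_minus_commute field_simps)
    have "2 *\<^sub>R \<xi> = m + (\<xi> - \<xi>')" by (simp add: m_def scaleR_2)
    then have "norm (2 *\<^sub>R \<xi>) \<le> norm m + norm (\<xi> - \<xi>')"
      by (simp only: norm_triangle_ineq)
    then have m: "norm m \<ge> 1" using \<xi> dist by simp
    then have m0: "m \<noteq> 0" by auto
    moreover have "reflect m x \<in> (K \<inter> perp \<xi>) + project_out \<xi> ` cball 0 \<delta>" if x: "x \<in> K" "x \<in> perp \<xi>'" for x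
    proof -
      have xm: "x \<bullet> m = x \<bullet> \<xi>" using x by (simp add: m_def perp_def inner_right_distrib)
      have "x \<bullet> \<xi> = x \<bullet> (\<xi> - \<xi>')" using x by (simp add: perp_def inner_diff_right)
      then have xx: "\<bar>x \<bullet> \<xi>\<bar> \<le> R * norm (\<xi> - \<xi>')"
        using Cauchy_Schwarz_ineq2[of x "\<xi> - \<xi>'"] mult_right_mono[OF R(2)[OF x(1)], of "norm (\<xi> - \<xi>')"] by simp
      then have "x \<in> U" using \<eta>(2)[OF x(1)] dist by fastforce
      then obtain a where a: "a \<in> K \<inter> perp \<xi>" "norm (x - a) < \<delta> / 2"
        by (auto simp: U_def dist_norm norm_minus_commute)
      have "norm (reflect m x - x) = 2 * \<bar>x \<bullet> m\<bar> / norm m"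
        using m0 by (simp add: reflect_def dot_square_norm power2_eq_square abs_mult)
      also have "\<dots> \<le> 2 * \<bar>x \<bullet> m\<bar> / 1" using m by (intro divide_left_mono) auto
      also have "\<dots> \<le> \<delta> / 2" using xx dist by (simp add: xm)
      finally have "norm (reflect m x - a) \<le> \<delta>"
        using a(2) norm_triangle_ineq[of "reflect m x - x" "x - a"] by simp
      moreover have "reflect m x \<in> perp \<xi>"
      proof -
        have "2 * (m \<bullet> \<xi>) = m \<bullet> m"
          using \<xi> \<xi>'(1) by (simp add: m_def norm_eq_1 inner_left_distrib inner_right_distrib inner_commute)
        then have "2 * (x \<bullet> m) / (m \<bullet> m) * (m \<bullet> \<xi>) = x \<bullet> m"
          using m0 by (simp add: field_simps)
        then show ?thesis by (simp add: perp_def reflect_def inner_diff_left xm)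
      qed
      then have "reflect m x - a \<in> perp \<xi>" using a(1) by (simp add: subspace_diff subspace_perp)
      ultimately have "reflect m x - a \<in> project_out \<xi> ` cball 0 \<delta>"
        by (metis project_out_id image_eqI mem_cball_0)
      then show ?thesis using a(1) by (metis set_plus_intro add.commute diff_add_cancel)
    qed
    ultimately show "\<xi> + \<xi>' \<noteq> 0 \<and> reflect (\<xi> + \<xi>') ` (K \<inter> perp \<xi>') \<subseteq> (K \<inter> perp \<xi>) + project_out \<xi> ` cball 0 \<delta>"
      unfolding m_def by blast
  qed
qed

text \<open>
  A single difference quotient at some \<open>t\<close> is already below \<open>y\<close>. A nearby section, reflected into the
  hyperplane of \<open>\<xi>\<close>, lies in \<open>A + \<delta>B\<close>; monotonicity bounds its surface area by the quotient of
  \<open>A + \<delta>B\<close> at \<open>t\<close>, which is at most \<open>(|A + (t + \<delta>)B| - |A|) / t\<close>. This is still below \<open>y\<close> for small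
  \<open>\<delta>\<close>.
\<close>
lemma section_area_usc:
  fixes K :: "(real ^ 'n::finite) set"
  assumes K: "compact K" "convex K" and \<xi>: "norm \<xi> = 1"
    and less: "surface_area (perp \<xi>) (K \<inter> perp \<xi>) < y"
  shows "\<exists>d>0. \<forall>\<xi>'. norm \<xi>' = 1 \<longrightarrow> dist \<xi>' \<xi> < d \<longrightarrow> surface_area (perp \<xi>') (K \<inter> perp \<xi>') < y"
proof -
  let ?P = "project_out \<xi>" and ?S = "closed_segment 0 \<xi>"
  define A where "A = K \<inter> perp \<xi>"
  define C where "C = A + ?S"
  have A: "compact A" "convex A" "A \<subseteq> perp \<xi>"
    using K by (auto simp: A_def intro!: compact_Int_closed closed_perp convex_Int convex_perp)
  have lin: "linear ?P" by (rule linear_project_out)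
  have C: "compact C" "convex C" using A by (simp_all add: C_def compact_set_plus convex_set_plus)
  have "growth_rate ?P C < y"
    using less surface_area_perp[OF \<xi> A(1,3)] by (simp add: A_def C_def)
  then have "\<forall>\<^sub>F t in at_right 0. (vol (C + ?P ` cball 0 t) - vol C) / t < y"
    by (rule order_tendstoD(2)[OF tendsto_growth_rate[OF C lin]])
  moreover have "\<forall>\<^sub>F t in at_right (0::real). t > 0" by (rule eventually_at_right_less)
  ultimately have "\<forall>\<^sub>F t in at_right 0. t > 0 \<and> (vol (C + ?P ` cball 0 t) - vol C) / t < y"
    by eventually_elim auto
  then have "\<exists>t. t > 0 \<and> (vol (C + ?P ` cball 0 t) - vol C) / t < y"
    by (rule eventually_happens'[OF trivial_limit_at_right_real])
  then obtain t where t: "t > 0" "(vol (C + ?P ` cball 0 t) - vol C) / t < y" by blast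
  define e where "e = y * t - (vol (C + ?P ` cball 0 t) - vol C)"
  have "e > 0" using t by (simp add: e_def field_simps)
  obtain \<delta> where \<delta>: "\<delta> > 0" "\<And>s. 0 \<le> s \<Longrightarrow> s \<le> \<delta> \<Longrightarrow> vol (C + ?P ` cball 0 (t + s)) < vol (C + ?P ` cball 0 t) + e"
    using vol_thicken_linear[OF C(1) lin \<open>e > 0\<close>, of t] t(1) by (metis less_imp_le)
  obtain d where d: "d > 0" "\<And>\<xi>'. norm \<xi>' = 1 \<Longrightarrow> dist \<xi>' \<xi> < d \<Longrightarrow>
    \<xi> + \<xi>' \<noteq> 0 \<and> reflect (\<xi> + \<xi>') ` (K \<inter> perp \<xi>') \<subseteq> A + ?P ` cball 0 \<delta>"
    unfolding A_def using section_near[OF K(1) \<xi> \<delta>(1)] by metis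
  have "surface_area (perp \<xi>') (K \<inter> perp \<xi>') < y" if \<xi>': "norm \<xi>' = 1" "dist \<xi>' \<xi> < d" for \<xi>'
  proof -
    define Q where "Q = reflect (\<xi> + \<xi>')"
    have Q: "orthogonal_transformation Q" unfolding Q_def by (rule orthogonal_reflect)
    have Q\<xi>: "Q \<xi>' = - \<xi>" unfolding Q_def using d(2)[OF \<xi>'] \<xi> \<xi>' by (intro reflect_sum_unit) auto
    define A' where "A' = Q ` (K \<inter> perp \<xi>')"
    have K': "compact (K \<inter> perp \<xi>')" "convex (K \<inter> perp \<xi>')"
      using K by (auto intro!: compact_Int_closed closed_perp convex_Int convex_perp)
    have A': "compact A'" "convex A'"
      using K' orthogonal_transformation_linear[OF Q] by (simp_all add: A'_def compact_linear_image convex_linear_image)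
    have perp: "perp (- \<xi>) = perp \<xi>" by (simp add: perp_def)
    have A'p: "A' \<subseteq> perp \<xi>"
      using Q Q\<xi> perp by (auto simp: A'_def orthogonal_transformation_def perp_def) (metis inner_minus_right neg_equal_0_iff_equal)
    define D where "D = C + ?P ` cball 0 \<delta>"
    have D: "compact D" "convex D"
      using C lin by (simp_all add: D_def compact_set_plus convex_set_plus compact_linear_image convex_linear_image)
    have "A' + ?S \<subseteq> (A + ?P ` cball 0 \<delta>) + ?S"
      using d(2)[OF \<xi>'] by (intro set_plus_mono2) (auto simp: A'_def Q_def)
    then have sub: "A' + ?S \<subseteq> D" by (simp add: D_def C_def add_ac)
    have "surface_area (perp \<xi>') (K \<inter> perp \<xi>') = surface_area (perp \<xi>) A'"
      using surface_area_orthogonal[OF Q \<xi>'(1) K'(1)] Q\<xi> by (simp add: A'_def perp)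
    also have "\<dots> = growth_rate ?P (A' + ?S)" by (rule surface_area_perp[OF \<xi> A'(1) A'p])
    also have "\<dots> \<le> growth_rate ?P D"
      using A' D sub lin by (intro growth_rate_mono compact_set_plus convex_set_plus) auto
    also have "\<dots> \<le> (vol (D + ?P ` cball 0 t) - vol D) / t"
      by (rule growth_rate_le[OF D lin t(1)])
    also have "\<dots> \<le> (vol (D + ?P ` cball 0 t) - vol C) / t"
    proof -
      have "0 \<in> ?P ` cball 0 \<delta>" using linear_0[OF lin] \<delta> by (auto simp: image_iff intro!: bexI[of _ 0])
      then have "C \<subseteq> D" unfolding D_def by (metis set_zero_plus2 add.commute)
      then show ?thesis using vol_mono[OF C(1) D(1)] t(1) by (intro divide_right_mono) auto
    qed
    also have "\<dots> < y"
    proof -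
      have "D + ?P ` cball 0 t = C + ?P ` cball 0 (t + \<delta>)"
        using t \<delta> by (simp add: D_def cball_plus_cball[symmetric] linear_image_set_plus[OF lin] add_ac)
      then have "vol (D + ?P ` cball 0 t) - vol C < y * t"
        using \<delta>(2)[of \<delta>] \<delta>(1) by (simp add: e_def)
      then show ?thesis using t(1) by (simp add: field_simps)
    qed
    finally show ?thesis .
  qed
  then show ?thesis using d(1) by blast
qed

lemma max_section_exists:
  fixes K :: "(real ^ 'n::finite) set"
  assumes "compact K" "convex K"
  obtains \<xi> where "\<xi> \<in> sphere 0 1"
    "\<And>\<xi>'. \<xi>' \<in> sphere 0 1 \<Longrightarrow> surface_area (perp \<xi>') (K \<inter> perp \<xi>') \<le> surface_area (perp \<xi>) (K \<inter> perp \<xi>)"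
proof -
  have "sphere (0 :: real ^ 'n) 1 \<noteq> {}" by simp
  then have "\<exists>\<xi>\<in>sphere (0 :: real ^ 'n) 1. \<forall>\<xi>'\<in>sphere 0 1.
      surface_area (perp \<xi>') (K \<inter> perp \<xi>') \<le> surface_area (perp \<xi>) (K \<inter> perp \<xi>)"
  proof (rule usc_attains_max[OF compact_sphere])
    fix \<xi> :: "real ^ 'n" and y
    assume "\<xi> \<in> sphere 0 1" "surface_area (perp \<xi>) (K \<inter> perp \<xi>) < y"
    then show "\<exists>d>0. \<forall>\<xi>'\<in>sphere 0 1. dist \<xi>' \<xi> < d \<longrightarrow> surface_area (perp \<xi>') (K \<inter> perp \<xi>') < y"
      using section_area_usc[OF assms, of \<xi> y] by auto
  qed
  then show thesis using that by blast
qed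

section \<open>A greedy orthogonal frame adapted to a body\<close>

definition residual :: "(nat \<Rightarrow> 'a::real_inner) \<Rightarrow> nat \<Rightarrow> 'a \<Rightarrow> 'a" where
  "residual e k v = v - (\<Sum>i<k. (v \<bullet> e i) *\<^sub>R e i)"

definition orthonormal_upto :: "nat \<Rightarrow> (nat \<Rightarrow> 'a::real_inner) \<Rightarrow> bool" where
  "orthonormal_upto k e \<longleftrightarrow> (\<forall>i<k. \<forall>j<k. e i \<bullet> e j = (if i = j then 1 else 0))"

lemma residual_orthogonal:
  assumes "orthonormal_upto k e" "j < k"
  shows "residual e k v \<bullet> e j = 0"
proof -
  have "(\<Sum>i<k. (v \<bullet> e i) * (e i \<bullet> e j)) = (\<Sum>i<k. if i = j then v \<bullet> e i else 0)"
    using assms by (intro sum.cong) (auto simp: orthonormal_upto_def)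
  then show ?thesis using assms(2) by (simp add: residual_def inner_diff_left inner_sum_left)
qed

lemma residual_inner_next:
  assumes "orthonormal_upto (Suc k) e"
  shows "residual e k v \<bullet> e k = v \<bullet> e k"
proof -
  have "(\<Sum>i<k. (v \<bullet> e i) * (e i \<bullet> e k)) = 0"
    using assms by (intro sum.neutral) (auto simp: orthonormal_upto_def)
  then show ?thesis by (simp add: residual_def inner_diff_left inner_sum_left)
qed

lemma residual_Suc: "residual e (Suc k) v = residual e k v - (v \<bullet> e k) *\<^sub>R e k"
  by (simp add: residual_def)

lemma orthonormal_upto_mono: "orthonormal_upto k e \<Longrightarrow> j \<le> k \<Longrightarrow> orthonormal_upto j e"
  by (auto simp: orthonormal_upto_def)

lemma norm_residual_antimono:
  assumes "orthonormal_upto k e" "j \<le> k"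
  shows "norm (residual e k v) \<le> norm (residual e j v)"
  using assms(2,1)
proof (induction k rule: dec_induct)
  case (step k)
  have "orthonormal_upto k e" using step.prems by (rule orthonormal_upto_mono) simp
  note IH = step.IH[OF this]
  have ek: "e k \<bullet> e k = 1" using step.prems by (simp add: orthonormal_upto_def)
  have "residual e (Suc k) v \<bullet> residual e (Suc k) v
      = residual e k v \<bullet> residual e k v - (v \<bullet> e k) * (v \<bullet> e k)"
    using residual_inner_next[OF step.prems, of v] inner_commute[of "e k" "residual e k v"] ek
    unfolding residual_Suc by (simp add: inner_diff_left inner_diff_right)
  also have "\<dots> \<le> residual e k v \<bullet> residual e k v" by simp
  finally have "norm (residual e (Suc k) v) \<le> norm (residual e k v)" by (simp add: norm_le)
  with IH show ?case by simp
qed simp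

lemma unit_normal_exists:
  fixes S :: "'a::euclidean_space set"
  assumes "finite S" "card S < DIM('a)"
  obtains \<nu> where "norm \<nu> = 1" "\<And>x. x \<in> S \<Longrightarrow> x \<bullet> \<nu> = 0"
proof -
  have "dim S < DIM('a)" using dim_le_card'[OF assms(1)] assms(2) by simp
  then obtain z where z: "z \<noteq> 0" "\<And>y. y \<in> span S \<Longrightarrow> orthogonal z y"
    using orthogonal_to_subspace_exists by blast
  show thesis
  proof (rule that[of "z /\<^sub>R norm z"])
    show "norm (z /\<^sub>R norm z) = 1" using z by simp
    fix x assume "x \<in> S"
    then show "x \<bullet> (z /\<^sub>R norm z) = 0" using z(2)[of x] span_base[of x S] by (simp add: orthogonal_def inner_commute)
  qed
qed

lemma orthonormal_expansion:
  fixes e :: "nat \<Rightarrow> 'a::euclidean_space"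
  assumes e: "orthonormal_upto (DIM('a)) e"
  shows "v = (\<Sum>i<DIM('a). (v \<bullet> e i) *\<^sub>R e i)"
proof -
  let ?B = "e ` {..<DIM('a)}"
  have inner: "e i \<bullet> e j = (if i = j then 1 else 0)" if "i < DIM('a)" "j < DIM('a)" for i j
    using e that by (simp add: orthonormal_upto_def)
  have inj: "inj_on e {..<DIM('a)}"
    by (rule inj_onI) (metis inner lessThan_iff zero_neq_one)
  have "independent ?B"
  proof (rule pairwise_orthogonal_independent)
    show "pairwise orthogonal ?B" by (auto simp: pairwise_def orthogonal_def inner)
    show "0 \<notin> ?B" using inner by (metis imageE inner_zero_left lessThan_iff zero_neq_one)
  qed
  moreover have "card ?B = DIM('a)" using inj by (simp add: card_image)
  ultimately have "UNIV \<subseteq> span ?B" by (intro card_ge_dim_independent) auto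
  then have "residual e (DIM('a)) v \<in> span ?B" by blast
  moreover have "x \<in> ?B \<Longrightarrow> orthogonal (residual e (DIM('a)) v) x" for x
    using residual_orthogonal[OF e] by (auto simp: orthogonal_def)
  ultimately have "orthogonal (residual e (DIM('a)) v) (residual e (DIM('a)) v)"
    by (metis orthogonal_to_span)
  then have "residual e (DIM('a)) v = 0" by (simp add: orthogonal_def)
  then show ?thesis by (simp add: residual_def)
qed

text \<open>
  The state after \<open>k\<close> greedy choices: \<open>p i\<close> is a point of \<open>K\<close> farthest from the affine hull of \<open>x0\<close>
  and the earlier points, \<open>d i\<close> is its distance, and \<open>e\<close> is the Gram-Schmidt frame of the \<open>p i - x0\<close>.
  The edges are therefore triangular with respect to \<open>e\<close>, with diagonal \<open>d\<close>.
\<close>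
definition adapted_frame ::
  "'a::euclidean_space set \<Rightarrow> 'a \<Rightarrow> nat \<Rightarrow> (nat \<Rightarrow> 'a) \<Rightarrow> (nat \<Rightarrow> real) \<Rightarrow> (nat \<Rightarrow> 'a) \<Rightarrow> bool" where
  "adapted_frame K x0 k e d p \<longleftrightarrow> orthonormal_upto k e \<and>
     (\<forall>i<k. d i > 0 \<and> p i \<in> K \<and> p i - x0 \<in> span (e ` {..i}) \<and> (p i - x0) \<bullet> e i = d i \<and>
        (\<forall>y\<in>K. norm (residual e i (y - x0)) \<le> d i)) \<and>
     (\<forall>i<k. \<forall>j<k. i \<le> j \<longrightarrow> d j \<le> d i)"

text \<open>
  The next point maximises the norm of the residual, which is its distance from the affine hull of
  the previous ones. The maximum is positive since \<open>K\<close>, having interior points, lies in no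
  hyperplane; and it does not exceed the earlier distances because residuals shrink as the frame
  grows.
\<close>
lemma adapted_frame_step:
  fixes K :: "'a::euclidean_space set"
  assumes K: "compact K" "interior K \<noteq> {}" and x0: "x0 \<in> K" and k: "k < DIM('a)"
    and fr: "adapted_frame K x0 k e d p"
  shows "\<exists>e d p. adapted_frame K x0 (Suc k) e d p"
proof -
  have on: "orthonormal_upto k e" using fr by (simp add: adapted_frame_def)
  have "continuous_on K (\<lambda>y. norm (residual e k (y - x0)))"
    unfolding residual_def by (intro continuous_intros)
  then obtain q where q: "q \<in> K" "\<And>y. y \<in> K \<Longrightarrow> norm (residual e k (y - x0)) \<le> norm (residual e k (q - x0))"
    using continuous_attains_sup[OF K(1)] x0 by blast
  define r where "r = residual e k (q - x0)"
  have "r \<noteq> 0"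
  proof
    assume "r = 0"
    then have zero: "residual e k (y - x0) = 0" if "y \<in> K" for y
      using q(2)[OF that] by (simp add: r_def)
    have "card (e ` {..<k}) < DIM('a)" using k card_image_le[of "{..<k}" e] by simp
    then obtain \<nu> where \<nu>: "norm \<nu> = 1" "\<And>x. x \<in> e ` {..<k} \<Longrightarrow> x \<bullet> \<nu> = 0"
      using unit_normal_exists[of "e ` {..<k}"] by blast
    have "\<nu> \<bullet> y = \<nu> \<bullet> x0" if "y \<in> K" for y
    proof -
      have "y - x0 = (\<Sum>i<k. ((y - x0) \<bullet> e i) *\<^sub>R e i)" using zero[OF that] by (simp add: residual_def)
      then have "(y - x0) \<bullet> \<nu> = (\<Sum>i<k. ((y - x0) \<bullet> e i) *\<^sub>R e i) \<bullet> \<nu>" by (rule arg_cong)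
      also have "\<dots> = 0" unfolding inner_sum_left by (intro sum.neutral) (simp add: \<nu>(2))
      finally have "y \<bullet> \<nu> = x0 \<bullet> \<nu>" by (simp add: inner_diff_left)
      then show ?thesis by (metis inner_commute)
    qed
    then have "interior K \<subseteq> interior {y. \<nu> \<bullet> y = \<nu> \<bullet> x0}" by (intro interior_mono) auto
    moreover have "interior {y. \<nu> \<bullet> y = \<nu> \<bullet> x0} = {}" using \<nu>(1) by (intro interior_hyperplane) auto
    ultimately show False using K(2) by simp
  qed
  define e' d' p' where "e' = e(k := r /\<^sub>R norm r)" and "d' = d(k := norm r)" and "p' = p(k := q)"
  have res: "residual e' i v = residual e i v" if "i \<le> k" for i v
    unfolding residual_def e'_def using that by (intro arg_cong2[where f = "(-)"] sum.cong) auto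
  have re: "r \<bullet> e j = 0" if "j < k" for j
    unfolding r_def by (rule residual_orthogonal[OF on that])
  have on': "orthonormal_upto (Suc k) e'"
  proof -
    have "norm (e' k) = 1" using \<open>r \<noteq> 0\<close> by (simp add: e'_def)
    then have "e' k \<bullet> e' k = 1" by (simp only: norm_eq_1)
    moreover have "e' j \<bullet> e' k = 0" "e' k \<bullet> e' j = 0" if "j < k" for j
      using re[OF that] that inner_commute[of "e j" r] by (simp_all add: e'_def)
    moreover have "e' i \<bullet> e' j = (if i = j then 1 else 0)" if "i < k" "j < k" for i j
      using on that by (simp add: e'_def orthonormal_upto_def)
    ultimately show ?thesis by (auto simp: orthonormal_upto_def less_Suc_eq)
  qed
  have "q - x0 = r + (\<Sum>i<k. ((q - x0) \<bullet> e i) *\<^sub>R e i)" by (simp add: r_def residual_def)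
  also have "r = norm r *\<^sub>R e' k" using \<open>r \<noteq> 0\<close> by (simp add: e'_def)
  also have "(\<Sum>i<k. ((q - x0) \<bullet> e i) *\<^sub>R e i) = (\<Sum>i<k. ((q - x0) \<bullet> e i) *\<^sub>R e' i)"
    by (intro sum.cong) (auto simp: e'_def)
  finally have qx: "q - x0 = norm r *\<^sub>R e' k + (\<Sum>i<k. ((q - x0) \<bullet> e i) *\<^sub>R e' i)" .
  have "norm r *\<^sub>R e' k + (\<Sum>i<k. ((q - x0) \<bullet> e i) *\<^sub>R e' i) \<in> span (e' ` {..k})"
    by (intro span_add span_sum span_mul span_base) auto
  then have span: "q - x0 \<in> span (e' ` {..k})" using qx by simp
  have "(q - x0) \<bullet> e' k = residual e' k (q - x0) \<bullet> e' k"
    using residual_inner_next[OF on'] by simp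
  also have "\<dots> = r \<bullet> e' k" by (simp add: res r_def)
  also have "\<dots> = norm r" using \<open>r \<noteq> 0\<close> by (simp add: e'_def dot_square_norm power2_eq_square)
  finally have coord: "(q - x0) \<bullet> e' k = norm r" .
  have old: "d i > 0 \<and> p i \<in> K \<and> p i - x0 \<in> span (e ` {..i}) \<and> (p i - x0) \<bullet> e i = d i \<and>
      (\<forall>y\<in>K. norm (residual e i (y - x0)) \<le> d i)" if "i < k" for i
    using fr that by (simp add: adapted_frame_def)
  have img: "e' ` {..i} = e ` {..i}" if "i < k" for i
    using that by (intro image_cong) (auto simp: e'_def)
  have "norm r \<le> d i" if "i < k" for i
    using norm_residual_antimono[OF on, of i "q - x0"] old[OF that] q(1) that
    by (auto simp: r_def intro: order_trans)
  then have mono: "\<forall>i<Suc k. \<forall>j<Suc k. i \<le> j \<longrightarrow> d' j \<le> d' i"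
    using fr by (auto simp: d'_def adapted_frame_def less_Suc_eq)
  have "d' i > 0 \<and> p' i \<in> K \<and> p' i - x0 \<in> span (e' ` {..i}) \<and> (p' i - x0) \<bullet> e' i = d' i \<and>
      (\<forall>y\<in>K. norm (residual e' i (y - x0)) \<le> d' i)" if "i < Suc k" for i
  proof (cases "i = k")
    case True
    then show ?thesis using q \<open>r \<noteq> 0\<close> span coord by (simp add: d'_def p'_def res r_def)
  next
    case False
    with that have "i < k" by simp
    moreover have "e' i = e i" using False by (simp add: e'_def)
    ultimately show ?thesis using old[OF \<open>i < k\<close>] False by (simp add: d'_def p'_def res img)
  qed
  then show ?thesis unfolding adapted_frame_def using on' mono by blast
qed

lemma adapted_frame_exists:
  fixes K :: "'a::euclidean_space set"
  assumes "compact K" "interior K \<noteq> {}" "x0 \<in> K" "k \<le> DIM('a)"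
  shows "\<exists>e d p. adapted_frame K x0 k e d p"
  using assms(4)
proof (induction k)
  case 0
  show ?case by (simp add: adapted_frame_def orthonormal_upto_def)
next
  case (Suc k)
  then obtain e d p where fr: "adapted_frame K x0 k e d p" by auto
  show ?case by (rule adapted_frame_step[OF assms(1-3) _ fr]) (use Suc.prems in simp)
qed

definition parallelepiped :: "('n::finite \<Rightarrow> real ^ 'n) \<Rightarrow> (real ^ 'n) set" where
  "parallelepiped w = (\<lambda>x. \<Sum>i\<in>UNIV. x $ i *\<^sub>R w i) ` cbox 0 1"

lemma linear_combination_linear: "linear (\<lambda>x :: real ^ 'n::finite. \<Sum>i\<in>UNIV. x $ i *\<^sub>R w i)"
  by (rule linearI) (auto simp: algebra_simps sum.distrib scaleR_right.sum)

lemma compact_parallelepiped: "compact (parallelepiped w)"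
  unfolding parallelepiped_def by (intro compact_linear_image linear_combination_linear) simp

lemma convex_parallelepiped: "convex (parallelepiped w)"
  unfolding parallelepiped_def by (intro convex_linear_image linear_combination_linear) simp

lemma enumeration_exists:
  obtains \<sigma> :: "'n::finite \<Rightarrow> nat" where "bij_betw \<sigma> UNIV {..<CARD('n)}"
  using ex_bij_betw_finite_nat[of "UNIV :: 'n set"] by (auto simp: atLeast0LessThan)

text \<open>
  The difference quotient at \<open>t = d m\<close>, the smallest of the distances, bounds the surface area. Since
  \<open>t\<close> is at most every \<open>d i\<close>, adding the ball of radius \<open>t\<close> at most doubles the box around \<open>K\<close>.
\<close>
lemma surface_area_upper_bound:
  fixes K :: "(real ^ 'n::finite) set"
  assumes K: "compact K" "convex K" "x0 \<in> K"
    and fr: "adapted_frame K x0 CARD('n) e d p" and n: "CARD('n) = Suc m"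
  shows "surface_area UNIV K \<le> 4 ^ CARD('n) * (\<Prod>i<m. d i)"
proof -
  obtain \<sigma> :: "'n \<Rightarrow> nat" where \<sigma>: "bij_betw \<sigma> UNIV {..<CARD('n)}" by (rule enumeration_exists)
  have \<sigma>lt: "\<sigma> i < CARD('n)" for i using \<sigma> by (auto simp: bij_betw_def)
  have \<sigma>inj: "inj \<sigma>" using \<sigma> by (auto simp: bij_betw_def)
  have on: "orthonormal_upto CARD('n) e" using fr by (simp add: adapted_frame_def)
  have ee: "e (\<sigma> i) \<bullet> e (\<sigma> j) = (if i = j then 1 else 0)" for i j
    using on \<sigma>lt \<sigma>inj by (auto simp: orthonormal_upto_def inj_def)
  have dpos: "d i > 0" if "i < CARD('n)" for i using fr that by (simp add: adapted_frame_def)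
  define w where "w i = (4 * d (\<sigma> i)) *\<^sub>R e (\<sigma> i)" for i
  have "vol (parallelepiped w) = (\<Prod>i\<in>UNIV. \<bar>w i \<bullet> e (\<sigma> i)\<bar>)"
    unfolding parallelepiped_def
    by (rule measure_parallelepiped[OF \<sigma>inj ee]) (auto simp: w_def ee)
  also have "\<dots> = (\<Prod>i\<in>UNIV. 4 * d (\<sigma> i))"
    using dpos[OF \<sigma>lt] by (intro prod.cong) (auto simp: w_def ee less_imp_le)
  also have "\<dots> = (\<Prod>i<CARD('n). 4 * d i)"
    by (rule prod.reindex_bij_betw[OF \<sigma>])
  also have "\<dots> = 4 ^ CARD('n) * (\<Prod>i<m. d i) * d m"
    by (simp add: prod.distrib n)
  finally have vol: "vol (parallelepiped w) = 4 ^ CARD('n) * (\<Prod>i<m. d i) * d m" .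
  \<comment> \<open>The corner of the doubled box around \<open>x0\<close>.\<close>
  define y0 where "y0 = x0 - (\<Sum>i\<in>UNIV. (2 * d (\<sigma> i)) *\<^sub>R e (\<sigma> i))"
  have dm: "d m > 0" "d m \<le> d i" if "i < CARD('n)" for i
    using fr that n by (simp_all add: adapted_frame_def)
  have sub: "K + cball 0 (d m) \<subseteq> {y0} + parallelepiped w"
  proof
    fix z assume "z \<in> K + cball 0 (d m)"
    then obtain y b where z: "z = y + b" "y \<in> K" "norm b \<le> d m" by (auto simp: set_plus_def)
    define c where "c i = (z - x0) \<bullet> e (\<sigma> i)" for i
    have c: "\<bar>c i\<bar> \<le> 2 * d (\<sigma> i)" for i
    proof -
      have e1: "norm (e (\<sigma> i)) = 1" using ee[of i i] by (simp add: norm_eq_1)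
      have "orthonormal_upto (Suc (\<sigma> i)) e" using \<sigma>lt[of i] by (intro orthonormal_upto_mono[OF on]) simp
      then have "\<bar>(y - x0) \<bullet> e (\<sigma> i)\<bar> = \<bar>residual e (\<sigma> i) (y - x0) \<bullet> e (\<sigma> i)\<bar>"
        by (simp add: residual_inner_next)
      also have "\<dots> \<le> norm (residual e (\<sigma> i) (y - x0))"
        using Cauchy_Schwarz_ineq2[of "residual e (\<sigma> i) (y - x0)" "e (\<sigma> i)"] e1 by simp
      also have "\<dots> \<le> d (\<sigma> i)" using fr z(2) \<sigma>lt[of i] by (simp add: adapted_frame_def)
      finally have "\<bar>(y - x0) \<bullet> e (\<sigma> i)\<bar> \<le> d (\<sigma> i)" .
      moreover have "\<bar>b \<bullet> e (\<sigma> i)\<bar> \<le> d (\<sigma> i)"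
        using Cauchy_Schwarz_ineq2[of b "e (\<sigma> i)"] e1 z(3) dm(2)[OF \<sigma>lt[of i]] by simp
      moreover have "c i = (y - x0) \<bullet> e (\<sigma> i) + b \<bullet> e (\<sigma> i)"
        by (simp add: c_def z(1) inner_diff_left inner_left_distrib)
      ultimately show ?thesis by linarith
    qed
    define x :: "real ^ 'n" where "x = (\<chi> i. (c i + 2 * d (\<sigma> i)) / (4 * d (\<sigma> i)))"
    have "x \<in> cbox 0 1"
      unfolding mem_box_cart
    proof
      fix i
      show "0 $ i \<le> x $ i \<and> x $ i \<le> 1 $ i"
        using c[of i] dpos[OF \<sigma>lt[of i]] by (simp add: x_def abs_le_iff)
    qed
    then have "(\<Sum>i\<in>UNIV. x $ i *\<^sub>R w i) \<in> parallelepiped w" unfolding parallelepiped_def by blast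
    moreover have "(\<Sum>i\<in>UNIV. x $ i *\<^sub>R w i) = (\<Sum>i\<in>UNIV. c i *\<^sub>R e (\<sigma> i)) + (\<Sum>i\<in>UNIV. (2 * d (\<sigma> i)) *\<^sub>R e (\<sigma> i))"
      unfolding sum.distrib[symmetric] scaleR_add_left[symmetric]
      by (intro sum.cong) (use dpos[OF \<sigma>lt] in \<open>auto simp: x_def w_def less_imp_neq[symmetric]\<close>)
    moreover have "(\<Sum>i\<in>UNIV. c i *\<^sub>R e (\<sigma> i)) = z - x0"
      using orthonormal_expansion[of e "z - x0"] on
        sum.reindex_bij_betw[OF \<sigma>, of "\<lambda>i. ((z - x0) \<bullet> e i) *\<^sub>R e i"] by (simp add: c_def)
    moreover have "z - y0 = (z - x0) + (\<Sum>i\<in>UNIV. (2 * d (\<sigma> i)) *\<^sub>R e (\<sigma> i))"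
      by (simp add: y0_def algebra_simps)
    ultimately have "z - y0 \<in> parallelepiped w" by (simp only:)
    then have "y0 + (z - y0) \<in> {y0} + parallelepiped w" by (intro set_plus_intro) auto
    then show "z \<in> {y0} + parallelepiped w" by simp
  qed
  have m: "m < CARD('n)" using n by simp
  have "surface_area UNIV K = growth_rate (\<lambda>x. x) K"
    using K by (intro surface_area_UNIV) auto
  also have "\<dots> \<le> (vol (K + (\<lambda>x. x) ` cball 0 (d m)) - vol K) / d m"
    using K dm(1)[OF m] by (intro growth_rate_le) (auto simp: linear_iff)
  also have "\<dots> \<le> vol (K + cball 0 (d m)) / d m"
    using dm(1)[OF m] by (intro divide_right_mono) auto
  also have "\<dots> \<le> vol ({y0} + parallelepiped w) / d m"
    using dm(1)[OF m] K sub by (intro divide_right_mono vol_mono compact_set_plus compact_parallelepiped) auto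
  also have "\<dots> = 4 ^ CARD('n) * (\<Prod>i<m. d i)"
    using dm(1)[OF m] by (simp add: vol_shift vol)
  finally show ?thesis .
qed

section \<open>Sections through the longest directions\<close>

lemma average_in_convex:
  assumes K: "convex K" "x0 \<in> K" and q: "\<And>j. j \<in> J \<Longrightarrow> q j \<in> K" and J: "finite J"
    and c: "\<And>j. j \<in> J \<Longrightarrow> 0 \<le> c j \<and> c j \<le> (1::real)"
  shows "x0 + (\<Sum>j\<in>J. (c j / real (card J)) *\<^sub>R (q j - x0)) \<in> K"
proof (cases "J = {}")
  case False
  define N where "N = real (card J)"
  have N: "N > 0" using False J by (simp add: N_def card_gt_0_iff)
  define y where "y j = x0 + c j *\<^sub>R (q j - x0)" for j
  have "y j \<in> K" if "j \<in> J" for j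
  proof -
    have "y j = (1 - c j) *\<^sub>R x0 + c j *\<^sub>R q j" by (simp add: y_def algebra_simps)
    then show ?thesis using K q[OF that] c[OF that] by (simp add: convex_def)
  qed
  then have "(\<Sum>j\<in>J. (1 / N) *\<^sub>R y j) \<in> K"
    using J K(1) N by (intro convex_sum) (auto simp: N_def)
  also have "(\<Sum>j\<in>J. (1 / N) *\<^sub>R y j) = (\<Sum>j\<in>J. (1 / N) *\<^sub>R x0) + (\<Sum>j\<in>J. (c j / N) *\<^sub>R (q j - x0))"
    by (simp add: y_def sum.distrib scaleR_add_right)
  also have "(\<Sum>j\<in>J. (1 / N) *\<^sub>R x0) = x0"
    using N by (simp add: N_def sum_constant_scaleR)
  finally show ?thesis by (simp add: N_def)
qed (use K in simp)

text \<open>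
  The vector \<open>\<xi>\<close> is orthogonal to \<open>x0\<close> and to \<open>e 0, \<dots>, e (m - 1)\<close>, so its hyperplane contains \<open>x0\<close> and
  all \<open>p i\<close> with \<open>i < m\<close>. The parallelepiped \<open>T\<close> at \<open>x0\<close> with edges \<open>(p i - x0) / m\<close> lies in the
  section and has codimension one in the hyperplane, with normal \<open>\<nu>\<close>. Hence the cylinder over \<open>T\<close> is
  null, while its parallel body contains the parallelepiped with the additional edges \<open>t \<nu>\<close> and
  \<open>\<xi>\<close>, whose volume is \<open>t P / m^m\<close>. For \<open>m = 0\<close> the set \<open>T\<close> is the point \<open>x0\<close>, and \<open>0^0 = 1\<close> is the
  correct value.
\<close>
lemma section_area_lower_bound:
  fixes K :: "(real ^ 'n::finite) set"
  assumes K: "compact K" "convex K" "x0 \<in> K"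
    and fr: "adapted_frame K x0 m e d p" and n: "CARD('n) = Suc (Suc m)"
  obtains \<xi> where "norm \<xi> = 1" "(\<Prod>i<m. d i) / real m ^ m \<le> surface_area (perp \<xi>) (K \<inter> perp \<xi>)"
proof -
  have on: "orthonormal_upto m e" using fr by (simp add: adapted_frame_def)
  have "card (insert x0 (e ` {..<m})) < DIM(real ^ 'n)"
    using card_insert_le_m1[of "Suc (card (e ` {..<m}))" "e ` {..<m}" x0] card_image_le[of "{..<m}" e] n
    by (auto simp: card_insert_if)
  then obtain \<xi> where \<xi>: "norm \<xi> = 1" "\<And>x. x \<in> insert x0 (e ` {..<m}) \<Longrightarrow> x \<bullet> \<xi> = 0"
    using unit_normal_exists[of "insert x0 (e ` {..<m})"] by auto
  have "card (insert \<xi> (e ` {..<m})) < DIM(real ^ 'n)"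
    using card_image_le[of "{..<m}" e] n by (auto simp: card_insert_if)
  then obtain \<nu> where \<nu>: "norm \<nu> = 1" "\<And>x. x \<in> insert \<xi> (e ` {..<m}) \<Longrightarrow> x \<bullet> \<nu> = 0"
    using unit_normal_exists[of "insert \<xi> (e ` {..<m})"] by auto
  define f where "f i = (if i < m then e i else if i = m then \<nu> else \<xi>)" for i
  have ff: "f i \<bullet> f j = (if i = j then 1 else 0)" if "i < Suc (Suc m)" "j < Suc (Suc m)" for i j
  proof -
    have "\<nu> \<bullet> \<nu> = 1" "\<xi> \<bullet> \<xi> = 1" using \<xi>(1) \<nu>(1) by (simp_all only: norm_eq_1)
    moreover have "\<xi> \<bullet> \<nu> = 0" "\<nu> \<bullet> \<xi> = 0" using \<nu>(2)[of \<xi>] by (simp_all add: inner_commute)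
    moreover have "e i \<bullet> \<nu> = 0" "\<nu> \<bullet> e i = 0" "e i \<bullet> \<xi> = 0" "\<xi> \<bullet> e i = 0" if "i < m" for i
      using \<nu>(2)[of "e i"] \<xi>(2)[of "e i"] that by (simp_all add: inner_commute)
    moreover have "e i \<bullet> e j = (if i = j then 1 else 0)" if "i < m" "j < m" for i j
      using on that by (simp add: orthonormal_upto_def)
    ultimately show ?thesis using that by (auto simp: f_def less_Suc_eq)
  qed
  have p: "p i \<in> K" "p i - x0 \<in> span (e ` {..i})" "(p i - x0) \<bullet> e i = d i" "d i > 0" if "i < m" for i
    using fr that by (simp_all add: adapted_frame_def)
  have pf: "(p i - x0) \<bullet> f j = 0" if "i < m" "i < j" "j < Suc (Suc m)" for i j
  proof -
    have "orthogonal (f j) (p i - x0)"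
    proof (rule orthogonal_to_span[OF p(2)[OF that(1)]])
      fix x assume "x \<in> e ` {..i}"
      then obtain l where "x = e l" "l \<le> i" by auto
      then have l: "x = f l" "l \<le> i" using that by (simp_all add: f_def)
      then show "orthogonal (f j) x" using ff[of j l] that by (simp add: orthogonal_def)
    qed
    then show ?thesis by (simp add: orthogonal_def inner_commute)
  qed
  obtain \<sigma> :: "'n \<Rightarrow> nat" where \<sigma>: "bij_betw \<sigma> UNIV {..<CARD('n)}" by (rule enumeration_exists)
  have \<sigma>lt: "\<sigma> i < Suc (Suc m)" for i using \<sigma> n by (auto simp: bij_betw_def)
  have \<sigma>inj: "inj \<sigma>" using \<sigma> by (auto simp: bij_betw_def)
  define J where "J = {i. \<sigma> i < m}"
  have cardJ: "card J = m"
  proof -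
    have "\<sigma> ` J = {..<m}" using \<sigma> n by (auto simp: J_def bij_betw_def image_iff)
    then show ?thesis using card_image[of \<sigma> J] \<sigma>inj by (metis card_lessThan inj_on_subset top_greatest)
  qed
  define v where "v i = (if \<sigma> i < m then (1 / real m) *\<^sub>R (p (\<sigma> i) - x0) else 0)" for i
  define T where "T = {x0} + parallelepiped v"
  define A where "A = K \<inter> perp \<xi>"
  let ?P = "project_out \<xi>" and ?S = "closed_segment 0 \<xi>"
  have lin: "linear ?P" by (rule linear_project_out)
  have T: "compact T" "convex T"
    by (simp_all add: T_def compact_set_plus convex_set_plus compact_parallelepiped convex_parallelepiped)
  have A: "compact A" "convex A" "A \<subseteq> perp \<xi>"
    using K by (auto simp: A_def intro!: compact_Int_closed closed_perp convex_Int convex_perp)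
  have vf: "v i \<bullet> \<xi> = 0" "v i \<bullet> \<nu> = 0" for i
    using pf[of "\<sigma> i" m] pf[of "\<sigma> i" "Suc m"] by (auto simp: v_def f_def)
  have TA: "T \<subseteq> A"
  proof
    fix z assume "z \<in> T"
    then obtain x where x: "x \<in> cbox 0 1" "z = x0 + (\<Sum>i\<in>UNIV. x $ i *\<^sub>R v i)"
      by (auto simp: T_def parallelepiped_def set_plus_def)
    have "(\<Sum>i\<in>UNIV. x $ i *\<^sub>R v i) = (\<Sum>i\<in>J. (x $ i / real (card J)) *\<^sub>R (p (\<sigma> i) - x0))"
      unfolding cardJ by (rule sum.mono_neutral_cong_right) (auto simp: v_def J_def)
    moreover have "x0 + (\<Sum>i\<in>J. (x $ i / real (card J)) *\<^sub>R (p (\<sigma> i) - x0)) \<in> K"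
      using x(1) by (intro average_in_convex K p(1)) (auto simp: J_def mem_box_cart)
    ultimately have "z \<in> K" using x(2) by simp
    moreover have "z \<bullet> \<xi> = 0"
      using \<xi>(2)[of x0] by (simp add: x(2) inner_left_distrib inner_sum_left vf)
    ultimately show "z \<in> A" by (simp add: A_def perp_def)
  qed
  have null: "vol (T + ?S) = 0"
  proof -
    have "T + ?S \<subseteq> {z. \<nu> \<bullet> z = \<nu> \<bullet> x0}"
    proof
      fix z assume "z \<in> T + ?S"
      then obtain x s where x: "z = x0 + (\<Sum>i\<in>UNIV. x $ i *\<^sub>R v i) + s *\<^sub>R \<xi>"
        by (auto simp: T_def parallelepiped_def set_plus_def in_segment)
      have "z \<bullet> \<nu> = x0 \<bullet> \<nu>"
        using \<nu>(2)[of \<xi>] by (simp add: x inner_left_distrib inner_sum_left vf)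
      then show "z \<in> {z. \<nu> \<bullet> z = \<nu> \<bullet> x0}" by (simp only: mem_Collect_eq inner_commute[of \<nu>])
    qed
    moreover have "negligible {z. \<nu> \<bullet> z = \<nu> \<bullet> x0}" using \<nu>(1) by (intro negligible_hyperplane) auto
    ultimately show ?thesis by (intro negligible_imp_measure0) (rule negligible_subset)
  qed
  have "(\<Prod>i<m. d i) / real m ^ m \<le> growth_rate ?P (T + ?S)"
  proof (rule growth_rate_ge)
    fix t :: real assume t: "t > 0"
    define w where "w i = v i + (if \<sigma> i = m then t *\<^sub>R \<nu> else if \<sigma> i = Suc m then \<xi> else 0)" for i
    have "vol (parallelepiped w) = (\<Prod>i\<in>UNIV. \<bar>w i \<bullet> f (\<sigma> i)\<bar>)"
      unfolding parallelepiped_def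
    proof (rule measure_parallelepiped[OF \<sigma>inj])
      show "f (\<sigma> i) \<bullet> f (\<sigma> j) = (if i = j then 1 else 0)" for i j
        using ff[OF \<sigma>lt \<sigma>lt] \<sigma>inj by (auto simp: inj_def)
      show "w i \<bullet> f (\<sigma> j) = 0" if "\<sigma> i < \<sigma> j" for i j
        using that \<sigma>lt[of j] pf[of "\<sigma> i" "\<sigma> j"] ff[of "\<sigma> i" "\<sigma> j"] \<nu>(2)[of \<xi>]
        by (auto simp: w_def v_def f_def inner_commute less_Suc_eq split: if_splits)
    qed
    also have "\<dots> = (\<Prod>i\<in>UNIV. if \<sigma> i < m then d (\<sigma> i) / real m else if \<sigma> i = m then t else 1)"
    proof (rule prod.cong)
      fix i
      have "\<nu> \<bullet> \<nu> = 1" "\<xi> \<bullet> \<xi> = 1" using \<xi>(1) \<nu>(1) by (simp_all only: norm_eq_1)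
      then show "\<bar>w i \<bullet> f (\<sigma> i)\<bar> = (if \<sigma> i < m then d (\<sigma> i) / real m else if \<sigma> i = m then t else 1)"
        using p(3)[of "\<sigma> i"] p(4)[of "\<sigma> i"] \<sigma>lt[of i] t by (auto simp: w_def v_def f_def less_Suc_eq)
    qed simp
    also have "\<dots> = (\<Prod>i<Suc (Suc m). if i < m then d i / real m else if i = m then t else 1)"
      using prod.reindex_bij_betw[OF \<sigma>, of "\<lambda>i. if i < m then d i / real m else if i = m then t else 1"]
      unfolding n .
    also have "\<dots> = (\<Prod>i<m. d i / real m) * t"
      by simp
    also have "(\<Prod>i<m. d i / real m) = (\<Prod>i<m. d i) / real m ^ m"
      by (simp add: prod_dividef)
    finally have volw: "vol (parallelepiped w) = (\<Prod>i<m. d i) / real m ^ m * t" .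
    have "{x0} + parallelepiped w \<subseteq> (T + ?S) + ?P ` cball 0 t"
    proof
      fix z assume "z \<in> {x0} + parallelepiped w"
      then obtain x where x: "x \<in> cbox 0 1" "z = x0 + (\<Sum>i\<in>UNIV. x $ i *\<^sub>R w i)"
        by (auto simp: parallelepiped_def set_plus_def)
      obtain a b where ab: "\<sigma> a = m" "\<sigma> b = Suc m"
        using \<sigma> n by (auto simp: bij_betw_def) (metis imageE lessThan_iff lessI less_SucI)
      have "(\<Sum>i\<in>UNIV. x $ i *\<^sub>R w i) = (\<Sum>i\<in>UNIV. x $ i *\<^sub>R v i)
          + (\<Sum>i\<in>UNIV. if i = a then x $ i *\<^sub>R t *\<^sub>R \<nu> else 0) + (\<Sum>i\<in>UNIV. if i = b then x $ i *\<^sub>R \<xi> else 0)"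
        unfolding sum.distrib[symmetric]
        by (intro sum.cong) (use ab \<sigma>inj in \<open>auto simp: w_def scaleR_add_right inj_def\<close>)
      then have z: "z = (x0 + (\<Sum>i\<in>UNIV. x $ i *\<^sub>R v i)) + x $ b *\<^sub>R \<xi> + (x $ a * t) *\<^sub>R \<nu>"
        using x(2) by (simp add: add_ac)
      have "x0 + (\<Sum>i\<in>UNIV. x $ i *\<^sub>R v i) \<in> T"
        unfolding T_def parallelepiped_def using x(1) by (intro set_plus_intro) auto
      moreover have "x $ b *\<^sub>R \<xi> \<in> ?S" using x(1) by (auto simp: in_segment mem_box_cart)
      moreover have "(x $ a * t) *\<^sub>R \<nu> \<in> ?P ` cball 0 t"
      proof (rule image_eqI)
        have "\<nu> \<bullet> \<xi> = 0" using \<nu>(2)[of \<xi>] by (simp add: inner_commute)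
        then show "(x $ a * t) *\<^sub>R \<nu> = ?P ((x $ a * t) *\<^sub>R \<nu>)" by (simp add: project_out_def)
        have "0 \<le> x $ a" "x $ a \<le> 1" using x(1) by (auto simp: mem_box_cart)
        then show "(x $ a * t) *\<^sub>R \<nu> \<in> cball 0 t" using t \<nu>(1) by (simp add: mult_left_le_one_le)
      qed
      ultimately show "z \<in> (T + ?S) + ?P ` cball 0 t" unfolding z by (intro set_plus_intro)
    qed
    then have "vol ({x0} + parallelepiped w) \<le> vol ((T + ?S) + ?P ` cball 0 t)"
      using T lin by (intro vol_mono compact_set_plus compact_parallelepiped compact_linear_image) auto
    then show "(\<Prod>i<m. d i) / real m ^ m * t \<le> vol ((T + ?S) + ?P ` cball 0 t) - vol (T + ?S)"
      by (simp only: vol_shift volw null)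
  qed (use T lin in \<open>auto intro!: compact_set_plus convex_set_plus\<close>)
  also have "\<dots> \<le> growth_rate ?P (A + ?S)"
    using T A TA lin by (intro growth_rate_mono compact_set_plus convex_set_plus set_plus_mono2) auto
  also have "\<dots> = surface_area (perp \<xi>) A"
    by (rule surface_area_perp[OF \<xi>(1) A(1,3), symmetric])
  finally show thesis using that[OF \<xi>(1)] by (simp add: A_def)
qed

lemma surface_area_nonneg:
  fixes K :: "(real ^ 'n::finite) set"
  assumes "compact K" "convex K" "K \<noteq> {}"
  shows "0 \<le> surface_area UNIV K"
  unfolding surface_area_UNIV[OF assms(1,3)]
proof (rule growth_rate_ge)
  fix t :: real assume "t > 0"
  have "0 \<in> cball (0 :: real ^ 'n) t" using \<open>t > 0\<close> by simp
  then have "K \<subseteq> K + cball 0 t" by (metis set_zero_plus2 add.commute)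
  then show "0 * t \<le> vol (K + (\<lambda>x. x) ` cball 0 t) - vol K"
    using assms(1) by (simp add: vol_mono compact_set_plus)
qed (use assms in \<open>auto simp: linear_iff\<close>)

text \<open>
  Eliminates \<open>D\<close> from the two hypotheses: \<open>S^(m+1) \<le> S (c P D)^m \<le> S (c P)^(m+1)\<close>, and the root of
  order \<open>m + 1\<close> gives the claim.
\<close>
lemma power_interpolation:
  fixes S P c D :: real
  assumes "0 \<le> S" "0 \<le> P" "1 \<le> c" "0 \<le> D" "S \<le> c * P * D" "D ^ m \<le> P"
  shows "S \<le> c * S powr (1 / (real m + 1)) * P"
proof -
  define s where "s = S powr (1 / (real m + 1))"
  have s: "s \<ge> 0" "s ^ Suc m = S"
  proof -
    show "s \<ge> 0" by (simp add: s_def)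
    show "s ^ Suc m = S"
    proof (cases "S = 0")
      case False
      then have "s ^ Suc m = s powr real (Suc m)"
        by (intro powr_realpow[symmetric]) (simp add: s_def)
      also have "\<dots> = S powr (1 / (real m + 1) * real (Suc m))" by (simp only: s_def powr_powr)
      also have "1 / (real m + 1) * real (Suc m) = 1" by (simp add: add.commute)
      finally show ?thesis using assms(1) False by simp
    qed (simp add: s_def)
  qed
  have "S ^ Suc m = S * S ^ m" by simp
  also have "\<dots> \<le> S * (c * P * D) ^ m"
    using assms by (intro mult_left_mono power_mono) auto
  also have "\<dots> = S * (c * P) ^ m * D ^ m" by (simp add: power_mult_distrib)
  also have "\<dots> \<le> S * (c * P) ^ m * P"
    using assms by (intro mult_left_mono) auto
  also have "\<dots> \<le> S * (c * P) ^ m * (c * P)"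
    using assms mult_right_mono[of 1 c P] by (intro mult_left_mono) auto
  also have "\<dots> = (c * s * P) ^ Suc m"
    by (simp add: s(2)[symmetric] power_mult_distrib mult_ac)
  finally have "S \<le> c * s * P"
    using assms s(1) by (intro power_le_imp_le_base[of S m "c * s * P"]) auto
  then show ?thesis by (simp add: s_def)
qed

theorem theorem1p5:
  assumes "CARD('n::finite) \<ge> 2"
  shows "\<exists>A>0. \<forall>K :: (real ^ 'n) set. convex_body K \<longrightarrow>
    (\<exists>M. (\<exists>\<xi>\<in>sphere 0 1. surface_area (perp \<xi>) (K \<inter> perp \<xi>) = M) \<and>
         (\<forall>\<xi>\<in>sphere 0 1. surface_area (perp \<xi>) (K \<inter> perp \<xi>) \<le> M) \<and>
         surface_area UNIV K
           \<le> A * surface_area UNIV K powr (1 / (real CARD('n) - 1)) * M)"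
proof -
  obtain m where n: "CARD('n) = Suc (Suc m)"
    using assms by (metis Suc_le_D numeral_2_eq_2 Suc_le_mono)
  have mm: "real m ^ m > 0" by (cases m) auto
  define A where "A = 4 ^ CARD('n) * real m ^ m"
  have "A > 0" using mm by (simp add: A_def)
  moreover have "\<exists>M. (\<exists>\<xi>\<in>sphere 0 1. surface_area (perp \<xi>) (K \<inter> perp \<xi>) = M) \<and>
         (\<forall>\<xi>\<in>sphere 0 1. surface_area (perp \<xi>) (K \<inter> perp \<xi>) \<le> M) \<and>
         surface_area UNIV K
           \<le> A * surface_area UNIV K powr (1 / (real CARD('n) - 1)) * M"
    if "convex_body K" for K :: "(real ^ 'n) set"
  proof -
    have K: "compact K" "convex K" "interior K \<noteq> {}" using that by (auto simp: convex_body_def)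
    then obtain x0 where x0: "x0 \<in> K" using interior_subset by blast
    obtain \<xi> where \<xi>: "\<xi> \<in> sphere 0 1"
      "\<And>\<xi>'. \<xi>' \<in> sphere 0 1 \<Longrightarrow> surface_area (perp \<xi>') (K \<inter> perp \<xi>') \<le> surface_area (perp \<xi>) (K \<inter> perp \<xi>)"
      using max_section_exists[OF K(1,2)] by blast
    define M where "M = surface_area (perp \<xi>) (K \<inter> perp \<xi>)"
    obtain e d p where fr: "adapted_frame K x0 CARD('n) e d p"
      using adapted_frame_exists[OF K(1,3) x0, of "CARD('n)"] by auto
    define P where "P = (\<Prod>i<m. d i)"
    have d: "d i > 0" if "i < CARD('n)" for i using fr that by (simp add: adapted_frame_def)
    have P: "P \<ge> 0" unfolding P_def by (intro prod_nonneg) (use d n in \<open>auto intro: less_imp_le\<close>)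
    have "adapted_frame K x0 m e d p"
      using fr n by (auto simp: adapted_frame_def orthonormal_upto_def)
    then obtain \<zeta> where "norm \<zeta> = 1" "P / real m ^ m \<le> surface_area (perp \<zeta>) (K \<inter> perp \<zeta>)"
      using section_area_lower_bound[OF K(1,2) x0 _ n] unfolding P_def by blast
    then have "P / real m ^ m \<le> M" using \<xi>(2)[of \<zeta>] by (simp add: M_def)
    then have PM: "P \<le> real m ^ m * M" using mm by (simp add: field_simps)
    let ?s = "surface_area UNIV K"
    have upper: "?s \<le> 4 ^ CARD('n) * P * d m"
      using surface_area_upper_bound[OF K(1,2) x0 fr n] by (simp add: P_def mult.assoc)
    have dm: "d m ^ m \<le> P"
    proof -
      have "0 \<le> d m" using d[of m] n by simp
      then have "(\<Prod>i<m. d m) \<le> P"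
        unfolding P_def using fr n by (intro prod_mono) (auto simp: adapted_frame_def)
      then show ?thesis by simp
    qed
    have "0 \<le> ?s" using K x0 by (intro surface_area_nonneg) auto
    moreover have "(1::real) \<le> 4 ^ CARD('n)" by (rule one_le_power) simp
    moreover have "0 \<le> d m" using d[of m] n by simp
    ultimately have "?s \<le> 4 ^ CARD('n) * ?s powr (1 / (real m + 1)) * P"
      using P upper dm by (intro power_interpolation[where D = "d m"])
    also have "\<dots> \<le> 4 ^ CARD('n) * ?s powr (1 / (real m + 1)) * (real m ^ m * M)"
      using PM by (intro mult_left_mono) auto
    also have "\<dots> = A * ?s powr (1 / (real CARD('n) - 1)) * M"
      by (simp add: A_def n add.commute mult_ac)
    finally show ?thesis using \<xi> unfolding M_def by blast
  qed
  ultimately show ?thesis by blast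
qed

end
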